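(* Let $n\ge1$ and $|t|>|q|^{-(n-2)}$. For $s=(s_1,\ldots,s_n)\in(\mathbb{C}^* )^n$ with $s_j/s_i\notin q^{\mathbb{Z}}$ $(1\le i<j\le n)$, $$\sum_{\theta\in M_n}c_n(\theta;s|q,t)\,t^{\sum_{i<j}(i-j)\theta_{ij}}=\prod_{i=1}^n\frac{(q/t;q)_\infty}{(q/t^i;q)_\infty}\prod_{1\le i<j\le n}\frac{(qs_j/ts_i;q)_\infty}{(qs_j/s_i;q)_\infty}.$$
   Context: Fix $q,t\in\mathbb{C}^*$ with $|q|<1$; $(z;q)_\infty=\prod_{k\ge0}(1-q^kz)$, $(z;q)_k=(z;q)_\infty/(q^kz;q)_\infty$. $M_n$ is the set of strictly upper triangular $n\times n$ matrices $\theta=(\theta_{ij})$ with entries in $\mathbb{N}=\{0,1,2,\ldots\}$. For $\theta\in M_n$, $$c_n(\theta;s|q,t)=\prod_{k=2}^{n}\prod_{1\le i<j\le k}\frac{(q^{\sum_{a>k}(\theta_{i,a}-\theta_{j,a})}ts_j/s_i;q)_{\theta_{i,k}}}{(q^{\sum_{a>k}(\theta_{i,a}-\theta_{j,a})}qs_j/s_i;q)_{\theta_{i,k}}}\cdot\prod_{k=2}^{n}\prod_{1\le i\le j<k}\frac{(q^{-\theta_{j,k}+\sum_{a>k}(\theta_{i,a}-\theta_{j,a})}qs_j/ts_i;q)_{\theta_{i,k}}}{(q^{-\theta_{j,k}+\sum_{a>k}(\theta_{i,a}-\theta_{j,a})}s_j/s_i;q)_{\theta_{i,k}}},$$ where $\sum_{a>k}=\sum_{a=k+1}^n$.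 The infinite sum is an absolutely convergent series. *)

theory Defs
  imports "HOL-Analysis.Analysis"
begin

definition qpoch_inf :: "complex \<Rightarrow> complex \<Rightarrow> complex" where
  "qpoch_inf z q = (\<Prod>k. 1 - q ^ k * z)"

text \<open>
  For a natural number \<open>k\<close> the quotient \<open>(z;q)\<^sub>\<infinity> / (q^k z;q)\<^sub>\<infinity>\<close> is the finite product below
  (lemma \<open>qpoch_eq_divide\<close>). The finite product is taken as the definition because the quotient
  becomes \<open>0/0\<close> when \<open>q^k z\<close> is a nonpositive power of \<open>q\<close>. That case does occur: the factors
  \<open>i = j\<close> in the coefficients contain \<open>(q^(-m);q)\<^sub>m\<close>, which is nonzero.
\<close>

definition qpoch :: "complex \<Rightarrow> complex \<Rightarrow> nat \<Rightarrow> complex" where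
  "qpoch z q k = (\<Prod>l<k. 1 - q ^ l * z)"

lemma convergent_qpoch_inf:
  assumes "norm q < 1"
  shows "convergent_prod (\<lambda>k. 1 - q ^ k * (z::complex))"
proof -
  have "summable (\<lambda>k. norm (1 - q ^ k * z - 1))"
    using assms by (simp add: norm_mult norm_power summable_mult2 summable_geometric)
  thus ?thesis
    using abs_convergent_prod_conv_summable abs_convergent_prod_imp_convergent_prod by blast
qed

lemma qpoch_mult_inf:
  assumes "norm q < 1"
  shows "qpoch z q k * qpoch_inf (q ^ k * z) q = qpoch_inf z q"
proof -
  have "qpoch_inf z q = (\<Prod>l<k. 1 - q ^ l * z) * (\<Prod>l. 1 - q ^ (l + k) * z)"
    using has_prod_unique[OF has_prod_ignore_initial_segment'[OF convergent_qpoch_inf[OF assms]], of z k]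
    by (simp add: qpoch_inf_def)
  thus ?thesis
    by (simp add: qpoch_inf_def qpoch_def power_add mult.assoc)
qed

lemma qpoch_eq_divide:
  assumes "norm q < 1" "qpoch_inf (q ^ k * z) q \<noteq> 0"
  shows "qpoch z q k = qpoch_inf z q / qpoch_inf (q ^ k * z) q"
  using qpoch_mult_inf[OF assms(1), of z k] assms(2) by (simp add: field_simps)

text \<open>
  Matrices with rows and columns numbered \<open>1, \<dots>, n\<close> are functions that vanish at all other
  index pairs, so that each matrix is represented exactly once.
\<close>

definition strict_upper_mats :: "nat \<Rightarrow> (nat \<Rightarrow> nat \<Rightarrow> nat) set" where
  "strict_upper_mats n = {\<theta>. \<forall>i j. \<theta> i j \<noteq> 0 \<longrightarrow> 1 \<le> i \<and> i < j \<and> j \<le> n}"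

definition tail_diff :: "nat \<Rightarrow> (nat \<Rightarrow> nat \<Rightarrow> nat) \<Rightarrow> nat \<Rightarrow> nat \<Rightarrow> nat \<Rightarrow> int" where
  "tail_diff n \<theta> k i j = (\<Sum>a=k+1..n. int (\<theta> i a) - int (\<theta> j a))"

definition c_coeff ::
  "nat \<Rightarrow> (nat \<Rightarrow> nat \<Rightarrow> nat) \<Rightarrow> (nat \<Rightarrow> complex) \<Rightarrow> complex \<Rightarrow> complex \<Rightarrow> complex" where
  "c_coeff n \<theta> s q t =
     (\<Prod>k=2..n. \<Prod>(i, j)\<in>{(i, j). 1 \<le> i \<and> i < j \<and> j \<le> k}.
        qpoch (q powi tail_diff n \<theta> k i j * (t * s j / s i)) q (\<theta> i k) /
        qpoch (q powi tail_diff n \<theta> k i j * (q * s j / s i)) q (\<theta> i k)) *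
     (\<Prod>k=2..n. \<Prod>(i, j)\<in>{(i, j). 1 \<le> i \<and> i \<le> j \<and> j < k}.
        qpoch (q powi (- int (\<theta> j k) + tail_diff n \<theta> k i j) * (q * s j / (t * s i))) q (\<theta> i k) /
        qpoch (q powi (- int (\<theta> j k) + tail_diff n \<theta> k i j) * (s j / s i)) q (\<theta> i k))"

end

theory Submission
  imports Defs
begin

text \<open>
  Splitting off the last column \<open>m\<close> of \<open>\<theta>\<close> replaces \<open>s\<^sub>i\<close> by \<open>q^(-m\<^sub>i) s\<^sub>i\<close> in the remaining
  coefficient. By induction on \<open>n\<close> the inner sum has a closed form, and the outer sum over \<open>m\<close>
  becomes Milne's \<open>A\<^sub>N\<close> extension of the q-Gauss sum with \<open>N = n - 1\<close>, \<open>z\<^sub>i = 1 / s\<^sub>i\<close>, \<open>a\<^sub>i = t\<close>,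
  \<open>b = t s\<^sub>n\<close>, \<open>c = q s\<^sub>n\<close>. Milne's sum follows from a first-order recurrence under \<open>c \<mapsto> q c\<close>,
  proved by telescoping, which is iterated until \<open>q^K c\<close> tends to \<open>0\<close> and the series to \<open>1\<close>.
  For absolute convergence the coefficients are shown to be bounded uniformly in \<open>\<theta>\<close>, so that
  \<open>norm t > 1\<close> suffices when \<open>n \<ge> 2\<close>.
\<close>

section \<open>Finite and infinite q-shifted factorials\<close>

text \<open>The outer sum becomes a known one because of how the inner value depends on
  \<open>m\<close>: the infinite products at the shifted ratios complete the finite factorials of
  the last column, and the mismatch that remains is a Vandermonde quotient in the points
  \<open>q ^ m i / s i\<close>. The induction has to run over all generic \<open>s\<close>, since
  the inner sum is needed at every shifted point; shifting changes ratios only by powers of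
  \<open>q\<close>, so genericity persists.

  Milne's sum is attacked through \<open>c\<close> because the argument of the series is
  proportional to \<open>c\<close>. Each step \<open>c \<mapsto> q c\<close> therefore damps a term
  of degree d by \<open>q ^ d\<close>, up to factors that stay bounded, while nodes and numerators
  remain fixed.

  Convergence cannot be read off factor by factor. Negative powers of \<open>q\<close> inside the
  factorials let single factors grow like powers of \<open>t / q\<close>, and only suitable products
  of two factors are bounded. Absolute convergence over whole matrices is what permits summing
  column by column.\<close>

lemma qpoch_0 [simp]: "qpoch z q 0 = 1"
  by (simp add: qpoch_def)

lemma qpoch_Suc: "qpoch z q (Suc k) = qpoch z q k * (1 - q ^ k * z)"
  by (simp add: qpoch_def)

lemma qpoch_add: "qpoch z q (j + k) = qpoch z q j * qpoch (q ^ j * z) q k"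
  by (induction k) (simp_all add: qpoch_Suc power_add mult_ac)

lemma qpoch_shift: "qpoch z q k * (1 - q ^ k * z) = (1 - z) * qpoch (q * z) q k"
  using qpoch_add[of z q k 1] qpoch_add[of z q 1 k] by (simp add: qpoch_Suc)

text \<open>The factor of \<open>qpoch (q powi (- int m) * y) q m\<close> with index
  \<open>l\<close> is \<open>1 - y / q ^ (m - l)\<close>. Extracting
  \<open>- y / q ^ (m - l)\<close> leaves the factor of \<open>qpoch (q / y) q m\<close> with index
  \<open>m - Suc l\<close>, and the parts extracted from numerator and denominator have quotient
  \<open>a\<close>.\<close>

lemma qpoch_quotient_reverse:
  assumes "q \<noteq> 0" "a \<noteq> 0" "y \<noteq> 0"
  shows "qpoch (q powi (- int m) * (a * y)) q m / qpoch (q powi (- int m) * y) q m =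
         a ^ m * (qpoch (q / (a * y)) q m / qpoch (q / y) q m)"
proof -
  have factor: "(1 - q ^ l * (q powi (- int m) * (a * y))) / (1 - q ^ l * (q powi (- int m) * y)) =
       a * ((1 - q ^ (m - Suc l) * (q / (a * y))) / (1 - q ^ (m - Suc l) * (q / y)))"
    if "l < m" for l
  proof -
    define r where "r = m - l"
    have "m = l + r" "r = Suc (m - Suc l)" using that by (auto simp: r_def)
    hence "q ^ m = q ^ l * q ^ r" "q ^ r = q * q ^ (m - Suc l)"
      using power_add[of q l r] power_Suc[of q "m - Suc l"] by (simp_all only:)
    hence "q ^ l * q powi (- int m) = inverse (q ^ r)" "q ^ (m - Suc l) * q = q ^ r"
      using assms(1) by (simp_all add: power_int_minus field_simps del: power_Suc)
    hence 1: "q ^ l * (q powi (- int m) * w) = w / q ^ r" "q ^ (m - Suc l) * (q / w) = q ^ r / w" for w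
      by (simp_all add: mult.assoc[symmetric] divide_inverse)
    have "q ^ r \<noteq> 0" using assms by simp
    \<comment> \<open>If \<open>y = q ^ r\<close>, the denominators on both sides vanish, and both
      quotients are 0.\<close>
    thus ?thesis unfolding 1 using assms
      by (cases "y = q ^ r") (auto simp: field_simps)
  qed
  have "qpoch (q powi (- int m) * (a * y)) q m / qpoch (q powi (- int m) * y) q m =
        (\<Prod>l<m. a * ((1 - q ^ (m - Suc l) * (q / (a * y))) / (1 - q ^ (m - Suc l) * (q / y))))"
    unfolding qpoch_def prod_dividef[symmetric] by (intro prod.cong factor) auto
  also have "\<dots> = (\<Prod>l<m. a * ((1 - q ^ l * (q / (a * y))) / (1 - q ^ l * (q / y))))"
    by (rule prod.nat_diff_reindex)
  finally show ?thesis by (simp add: qpoch_def prod.distrib prod_dividef)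
qed

lemma qpoch_inf_nonzero:
  assumes "norm q < 1" "\<And>k. q ^ k * z \<noteq> 1"
  shows "qpoch_inf z q \<noteq> 0"
  unfolding qpoch_inf_def
  using convergent_qpoch_inf[OF assms(1), of z] assms(2) prodinf_nonzero[of "\<lambda>k. 1 - q ^ k * z"] by simp

lemma qpoch_tendsto_inf:
  assumes "norm q < 1"
  shows "(\<lambda>k. qpoch z q k) \<longlonglongrightarrow> qpoch_inf z q"
proof -
  have "(\<lambda>k. \<Prod>l\<le>k. 1 - q ^ l * z) \<longlonglongrightarrow> qpoch_inf z q"
    unfolding qpoch_inf_def
    using convergent_qpoch_inf[OF assms, of z] by (rule convergent_prod_LIMSEQ)
  hence "(\<lambda>k. qpoch z q (Suc k)) \<longlonglongrightarrow> qpoch_inf z q"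
    by (simp add: qpoch_def lessThan_Suc_atMost)
  thus ?thesis by (rule LIMSEQ_imp_Suc)
qed

section \<open>Bounds uniform in a parameter\<close>

lemma bounded_prod:
  fixes f :: "'a \<Rightarrow> 'p \<Rightarrow> 'b :: real_normed_field"
  assumes "finite A" "\<And>a. a \<in> A \<Longrightarrow> \<exists>C. \<forall>p. norm (f a p) \<le> C"
  shows "\<exists>C. \<forall>p. norm (\<Prod>a\<in>A. f a p) \<le> C"
proof -
  obtain C where C: "\<And>a p. a \<in> A \<Longrightarrow> norm (f a p) \<le> C a"
    using assms(2) by metis
  have "norm (\<Prod>a\<in>A. f a p) \<le> (\<Prod>a\<in>A. C a)" for p
    unfolding prod_norm[symmetric] by (intro prod_mono) (auto intro: C)
  thus ?thesis by blast
qed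

lemma bounded_mult:
  fixes f g :: "'p \<Rightarrow> 'b :: real_normed_field"
  assumes "\<exists>C. \<forall>p. norm (f p) \<le> C" "\<exists>C. \<forall>p. norm (g p) \<le> C"
  shows "\<exists>C. \<forall>p. norm (f p * g p) \<le> C"
proof -
  from assms obtain C D where CD: "\<And>p. norm (f p) \<le> C" "\<And>p. norm (g p) \<le> D" by blast
  have "norm (f p * g p) \<le> C * D" for p
    using CD[of p] norm_ge_zero[of "f p"] norm_ge_zero[of "g p"] unfolding norm_mult
    by (intro mult_mono) linarith+
  thus ?thesis by blast
qed

lemma sum_power_inj_le:
  fixes r :: real
  assumes "0 \<le> r" "r < 1" "finite A" "inj_on h A"
  shows "(\<Sum>l\<in>A. r ^ h l) \<le> 1 / (1 - r)"
proof -
  have "(\<Sum>l\<in>A. r ^ h l) = sum ((^) r) (h ` A)"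
    using assms by (simp add: sum.reindex)
  also have "\<dots> \<le> suminf ((^) r)"
    using assms by (intro sum_le_suminf) auto
  also have "\<dots> = 1 / (1 - r)"
    using assms by (intro suminf_geometric) auto
  finally show ?thesis .
qed

text \<open>By \<open>1 + x \<le> exp x\<close> the product is controlled by part of a geometric
  series, since the exponents \<open>h l\<close> are distinct. The bound depends neither on
  \<open>A\<close> nor on \<open>h\<close>, so it serves factorials of every length and starting
  point.\<close>

lemma prod_one_plus_power_le:
  fixes r K :: real
  assumes "0 \<le> r" "r < 1" "K \<ge> 0" "finite A" "inj_on h A"
  shows "(\<Prod>l\<in>A. 1 + K * r ^ h l) \<le> exp (K / (1 - r))"
proof -
  have "(\<Prod>l\<in>A. 1 + K * r ^ h l) \<le> (\<Prod>l\<in>A. exp (K * r ^ h l))"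
    using assms by (intro prod_mono conjI exp_ge_add_one_self) (simp add: add_nonneg_nonneg)
  also have "\<dots> = exp (K * (\<Sum>l\<in>A. r ^ h l))"
    using assms by (simp add: exp_sum sum_distrib_left)
  also have "\<dots> \<le> exp (K / (1 - r))"
    using mult_left_mono[OF sum_power_inj_le[OF assms(1,2,4,5)] assms(3)] by simp
  finally show ?thesis .
qed

text \<open>The quotient is 1 plus \<open>q ^ p\<close> times
  \<open>y * (1 - a) / (1 - q ^ p * y)\<close>, and the denominators are nonzero and tend to 1, so
  their inverses are bounded.\<close>

lemma qfactor_bound:
  fixes q y a :: complex
  assumes "norm q < 1" "\<And>p::nat. q ^ p * y \<noteq> 1"
  obtains K where "K \<ge> 0" "\<And>p. norm ((1 - q ^ p * (a * y)) / (1 - q ^ p * y)) \<le> 1 + K * norm q ^ p"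
proof -
  have "(\<lambda>p. q ^ p * y) \<longlonglongrightarrow> 0 * y"
    by (intro tendsto_mult_right LIMSEQ_power_zero assms(1))
  hence "(\<lambda>p. inverse (1 - q ^ p * y)) \<longlonglongrightarrow> inverse (1 - 0 * y)"
    by (intro tendsto_intros) (use assms in auto)
  hence "Bseq (\<lambda>p. inverse (1 - q ^ p * y))"
    by (intro convergent_imp_Bseq convergentI)
  then obtain M where M: "M > 0" "\<And>p. norm (inverse (1 - q ^ p * y)) \<le> M"
    by (auto simp: Bseq_def)
  show ?thesis
  proof
    show "norm (y * (1 - a)) * M \<ge> 0" using M by simp
    fix p
    have "(1 - q ^ p * (a * y)) / (1 - q ^ p * y) = 1 + y * (1 - a) * inverse (1 - q ^ p * y) * q ^ p"
      using assms(2)[of p] by (simp add: field_simps)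
    also have "norm \<dots> \<le> 1 + norm (y * (1 - a) * inverse (1 - q ^ p * y) * q ^ p)"
      by (rule norm_triangle_le) simp
    also have "\<dots> = 1 + norm (y * (1 - a)) * norm (inverse (1 - q ^ p * y)) * norm q ^ p"
      by (simp add: norm_mult norm_power)
    also have "\<dots> \<le> 1 + norm (y * (1 - a)) * M * norm q ^ p"
      using M(2)[of p] by (intro add_left_mono mult_right_mono mult_left_mono) auto
    finally show "norm ((1 - q ^ p * (a * y)) / (1 - q ^ p * y)) \<le> 1 + norm (y * (1 - a)) * M * norm q ^ p" .
  qed
qed

lemma qpoch_bounded:
  assumes "norm q < 1"
  shows "\<exists>C. \<forall>m. norm (qpoch z q m) \<le> C"
  using convergent_imp_Bseq[OF convergentI[OF qpoch_tendsto_inf[OF assms]], of z]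
  by (auto simp: Bseq_def)

text \<open>The case \<open>a = 0\<close> of \<open>qfactor_bound\<close>. The offset
  \<open>e\<close> is there for the series with \<open>q ^ K * c\<close> in place of
  \<open>c\<close>, whose bound must not depend on \<open>K\<close>.\<close>

lemma inverse_qpoch_bounded:
  assumes "norm q < 1" "\<And>p::nat. q ^ p * y \<noteq> 1"
  shows "\<exists>C. \<forall>e m. norm (inverse (qpoch (q ^ e * y) q m)) \<le> C"
proof -
  obtain K where K: "K \<ge> 0" "\<And>p. norm (1 / (1 - q ^ p * y)) \<le> 1 + K * norm q ^ p"
    using qfactor_bound[OF assms, of 0] by auto
  have "norm (inverse (qpoch (q ^ e * y) q m)) \<le> exp (K / (1 - norm q))" for e m
  proof -
    have "norm (inverse (qpoch (q ^ e * y) q m)) = (\<Prod>l<m. norm (1 / (1 - q ^ (e + l) * y)))"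
      by (simp add: qpoch_def inverse_eq_divide norm_divide power_add mult_ac prod_dividef flip: prod_norm)
    also have "\<dots> \<le> (\<Prod>l<m. 1 + K * norm q ^ (e + l))"
      using K by (intro prod_mono) auto
    also have "\<dots> \<le> exp (K / (1 - norm q))"
      using assms K by (intro prod_one_plus_power_le) (auto simp: inj_on_def)
    finally show ?thesis .
  qed
  thus ?thesis by blast
qed

text \<open>The factors are sorted by the sign of the exponent \<open>e + l\<close>. Those with
  nonnegative exponent multiply to something bounded. Those with negative exponent are close to
  \<open>a\<close> instead of 1: reversing them gives \<open>a\<close> times a factor of the first
  kind for \<open>1 / a\<close> and \<open>1 / y\<close>. Their number is
  \<open>min m (nat (- e))\<close>.\<close>

lemma qpoch_quotient_bound:
  assumes "q \<noteq> 0" "norm q < 1" "a \<noteq> 0" "y \<noteq> 0" "\<And>k::int. y \<noteq> q powi k"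
  shows "\<exists>C. \<forall>e m. norm (qpoch (q powi e * (a * y)) q m / qpoch (q powi e * y) q m)
                 \<le> C * norm a ^ min m (nat (- e))"
proof -
  have 1: "q ^ p * y \<noteq> 1" for p
    using assms(5)[of "- int p"] assms(1) by (auto simp: power_int_minus field_simps)
  have 2: "q ^ p * (1 / y) \<noteq> 1" for p
    using assms(5)[of "int p"] assms(1,4) by (auto simp: field_simps)
  obtain K where K: "K \<ge> 0" "\<And>p. norm ((1 - q ^ p * (a * y)) / (1 - q ^ p * y)) \<le> 1 + K * norm q ^ p"
    using qfactor_bound[OF assms(2) 1] by metis
  obtain L where L: "L \<ge> 0"
    "\<And>p. norm ((1 - q ^ p * (1 / a * (1 / y))) / (1 - q ^ p * (1 / y))) \<le> 1 + L * norm q ^ p"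
    using qfactor_bound[OF assms(2) 2] by metis
  define \<phi> where "\<phi> k = (1 - q powi k * (a * y)) / (1 - q powi k * y)" for k :: int
  have pos: "norm (\<phi> k) \<le> 1 + K * norm q ^ nat k" if "k \<ge> 0" for k
    using K(2)[of "nat k"] that by (simp add: \<phi>_def power_int_def)
  have neg: "norm (\<phi> k) \<le> norm a * (1 + L * norm q ^ nat (- k))" if "k < 0" for k
  proof -
    define r where "r = q ^ nat (- k)"
    have r: "r \<noteq> 0" "q powi k = 1 / r" "r \<noteq> y"
      using that assms(1) assms(5)[of "- k"] by (auto simp: r_def power_int_def field_simps)
    have "(1 - 1 / r * (a * y)) / (1 - 1 / r * y) = a * ((1 - r * (1 / a * (1 / y))) / (1 - r * (1 / y)))"
      using r(1,3) assms(3,4) by (simp add: divide_simps) (simp add: algebra_simps)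
    hence "\<phi> k = a * ((1 - r * (1 / a * (1 / y))) / (1 - r * (1 / y)))"
      using r(2) by (simp add: \<phi>_def)
    thus ?thesis using L(2)[of "nat (- k)"]
      by (simp add: norm_mult r_def mult_left_mono del: times_divide_eq_right)
  qed
  have "norm (qpoch (q powi e * (a * y)) q m / qpoch (q powi e * y) q m)
          \<le> exp (K / (1 - norm q)) * exp (L / (1 - norm q)) * norm a ^ min m (nat (- e))" for e m
  proof -
    let ?P = "{l. l < m \<and> e + int l \<ge> 0}" and ?N = "{..<min m (nat (- e))}"
    have split: "{..<m} = ?P \<union> ?N" "?P \<inter> ?N = {}" by auto
    have "q powi e * q ^ l = q powi (e + int l)" for l
      using assms(1) by (simp add: power_int_add)
    hence "norm (qpoch (q powi e * (a * y)) q m / qpoch (q powi e * y) q m) = (\<Prod>l<m. norm (\<phi> (e + int l)))"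
      by (simp add: qpoch_def \<phi>_def norm_divide prod_dividef mult.assoc[symmetric] mult.commute[of "q ^ _"]
          flip: prod_norm)
    also have "\<dots> = (\<Prod>l\<in>?P. norm (\<phi> (e + int l))) * (\<Prod>l\<in>?N. norm (\<phi> (e + int l)))"
      unfolding split(1) by (rule prod.union_disjoint) (use split in auto)
    also have "\<dots> \<le> (\<Prod>l\<in>?P. 1 + K * norm q ^ nat (e + int l)) *
                  (\<Prod>l\<in>?N. norm a * (1 + L * norm q ^ nat (- (e + int l))))"
      using K(1) by (intro mult_mono prod_mono conjI pos neg prod_nonneg) auto
    also have "\<dots> = (\<Prod>l\<in>?P. 1 + K * norm q ^ nat (e + int l)) *
                  (\<Prod>l\<in>?N. 1 + L * norm q ^ nat (- (e + int l))) * norm a ^ min m (nat (- e))"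
      by (simp add: prod.distrib)
    also have "\<dots> \<le> exp (K / (1 - norm q)) * exp (L / (1 - norm q)) * norm a ^ min m (nat (- e))"
      using K(1) L(1) assms(2)
      by (intro mult_right_mono mult_mono prod_one_plus_power_le prod_nonneg) (auto simp: inj_on_def)
    finally show ?thesis .
  qed
  thus ?thesis by blast
qed

section \<open>Lagrange interpolation at the origin\<close>

text \<open>Only a bound on the degree, because some \<open>\<alpha> j\<close> may vanish; the
  coefficient at \<open>card I\<close> is then 0 and the formula still holds.\<close>

lemma poly_prod_linear:
  fixes \<alpha> :: "'i \<Rightarrow> 'a :: idom"
  assumes "finite I"
  shows "degree (\<Prod>j\<in>I. [:1, - \<alpha> j:]) \<le> card I \<and>
         coeff (\<Prod>j\<in>I. [:1, - \<alpha> j:]) (card I) = (\<Prod>j\<in>I. - \<alpha> j)"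
  using assms
proof induction
  case (insert k I)
  define P where "P = (\<Prod>j\<in>I. [:1, - \<alpha> j:])"
  have "degree ([:1, - \<alpha> k:] * P) \<le> degree [:1, - \<alpha> k:] + degree P" by (rule degree_mult_le)
  moreover have "degree [:1, - \<alpha> k:] \<le> 1" by simp
  moreover have "coeff P (Suc (card I)) = 0"
    using insert.IH by (intro coeff_eq_0) (simp add: P_def)
  ultimately show ?case using insert by (simp add: P_def[symmetric])
qed auto

text \<open>The nodes determine only polynomials of degree below \<open>card I\<close>; the last
  term on the right corrects for the one further degree. The weights are the Lagrange basis
  polynomials at 0, because \<open>(0 - x j) / (x i - x j)\<close> is the inverse of
  \<open>1 - x i / x j\<close>.\<close>

lemma lagrange_at_zero:
  fixes x :: "'i \<Rightarrow> 'a :: field"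
  assumes fin: "finite I" and inj: "inj_on x I" and nz: "\<And>i. i \<in> I \<Longrightarrow> x i \<noteq> 0"
    and deg: "degree p \<le> card I"
  shows "(\<Sum>i\<in>I. poly p (x i) / (\<Prod>j\<in>I-{i}. 1 - x i / x j)) =
         poly p 0 - coeff p (card I) * (\<Prod>j\<in>I. - x j)"
proof (cases "I = {}")
  case True
  thus ?thesis by (simp add: poly_0_coeff_0)
next
  case False
  define N where "N = card I"
  have N: "N > 0" using False fin by (simp add: N_def card_gt_0_iff)
  define V where "V J = (\<Prod>j\<in>J. [:- x j, 1:])" for J
  have degV: "degree (V J) = card J" if "finite J" for J
    using that unfolding V_def by (subst degree_prod_eq_sum_degree) auto
  have leadV: "lead_coeff (V J) = 1" if "finite J" for J
    using that unfolding V_def by (simp add: lead_coeff_prod)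
  have polyV: "poly (V J) y = (\<Prod>j\<in>J. y - x j)" for J y
    by (simp add: V_def poly_prod)
  \<comment> \<open>\<open>V I\<close> vanishes at all nodes and is monic, so the values there are
    kept while the coefficient at \<open>N\<close> disappears.\<close>
  define Q where "Q = p - smult (coeff p N) (V I)"
  have "coeff (V I) N = 1" using leadV[OF fin] degV[OF fin] by (simp add: N_def)
  hence "coeff Q N = 0" by (simp add: Q_def)
  moreover have "degree Q \<le> N"
    unfolding Q_def using deg degV[OF fin] by (intro degree_diff_le degree_smult_le[THEN order_trans]) (auto simp: N_def)
  ultimately have degQ: "degree Q < N"
    using N eq_zero_or_degree_less by fastforce
  have rootQ: "poly Q (x i) = poly p (x i)" if "i \<in> I" for i
    using that fin by (auto simp: Q_def polyV)
  define L where "L = (\<Sum>i\<in>I. smult (poly p (x i) / poly (V (I - {i})) (x i)) (V (I - {i})))"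
  have "degree L \<le> N - 1"
    unfolding L_def using fin degV
    by (intro degree_sum_le degree_smult_le[THEN order_trans]) (auto simp: N_def)
  hence degD: "degree (Q - L) < N"
    using degQ N by (intro degree_diff_less) auto
  have "poly L (x k) = poly p (x k)" if "k \<in> I" for k
  proof -
    have "poly L (x k) = (\<Sum>i\<in>I. if i = k then poly p (x k) else 0)"
      unfolding L_def poly_sum
    proof (intro sum.cong refl)
      fix i assume "i \<in> I"
      show "poly (smult (poly p (x i) / poly (V (I - {i})) (x i)) (V (I - {i}))) (x k) =
            (if i = k then poly p (x k) else 0)"
      proof (cases "i = k")
        case True
        have "poly (V (I - {k})) (x k) \<noteq> 0"
          using inj fin that by (auto simp: polyV inj_on_def)
        thus ?thesis using True by simp
      next
        case False
        hence "poly (V (I - {i})) (x k) = 0"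
          using fin that unfolding polyV by (intro prod_zero) auto
        thus ?thesis using False by simp
      qed
    qed
    thus ?thesis using that fin by simp
  qed
  hence "x ` I \<subseteq> {y. poly (Q - L) y = 0}" using rootQ by auto
  hence "N \<le> card {y. poly (Q - L) y = 0}" if "Q - L \<noteq> 0"
    using card_mono[OF poly_roots_finite[OF that]] card_image[OF inj] unfolding N_def by metis
  hence "Q - L = 0"
    using card_poly_roots_bound[of "Q - L"] degD by fastforce
  hence "poly Q 0 = poly L 0" by simp
  moreover have "poly Q 0 = poly p 0 - coeff p N * (\<Prod>j\<in>I. - x j)"
    by (simp add: Q_def polyV)
  moreover have "poly L 0 = (\<Sum>i\<in>I. poly p (x i) / (\<Prod>j\<in>I-{i}. 1 - x i / x j))"
    unfolding L_def poly_sum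
  proof (intro sum.cong refl)
    fix i assume "i \<in> I"
    have "poly (V (I - {i})) 0 / poly (V (I - {i})) (x i) = (\<Prod>j\<in>I-{i}. inverse (1 - x i / x j))"
      unfolding polyV prod_dividef[symmetric]
    proof (intro prod.cong refl)
      fix j assume "j \<in> I - {i}"
      hence "x j \<noteq> 0" "x i \<noteq> x j" using nz inj \<open>i \<in> I\<close> by (auto simp: inj_on_def)
      thus "(0 - x j) / (x i - x j) = inverse (1 - x i / x j)"
        by (simp add: divide_simps) (simp add: algebra_simps)
    qed
    thus "poly (smult (poly p (x i) / poly (V (I - {i})) (x i)) (V (I - {i}))) 0 =
          poly p (x i) / (\<Prod>j\<in>I-{i}. 1 - x i / x j)"
      by (simp add: prod_inversef[symmetric] divide_inverse mult_ac)
  qed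
  ultimately show ?thesis by (simp add: N_def)
qed

lemma lagrange_prod:
  fixes x :: "'i \<Rightarrow> 'a :: field"
  assumes "finite I" "inj_on x I" "\<And>i. i \<in> I \<Longrightarrow> x i \<noteq> 0"
  shows "(\<Sum>i\<in>I. (\<Prod>j\<in>I. 1 - \<alpha> j * x i) / (\<Prod>j\<in>I-{i}. 1 - x i / x j)) = 1 - (\<Prod>j\<in>I. \<alpha> j * x j)"
proof -
  have "(\<Prod>j\<in>I. - \<alpha> j) * (\<Prod>j\<in>I. - x j) = (\<Prod>j\<in>I. \<alpha> j * x j)"
    by (simp flip: prod.distrib)
  thus ?thesis
    using lagrange_at_zero[OF assms, of "\<Prod>j\<in>I. [:1, - \<alpha> j:]"] poly_prod_linear[OF assms(1), of \<alpha>]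
    by (simp add: poly_prod mult.commute)
qed

text \<open>This is \<open>lagrange_prod\<close> with one more node \<open>1 / c\<close>, indexed by
  \<open>None\<close> and given the numerator parameter \<open>b\<close>. For the old nodes it
  contributes the denominator \<open>1 - c * x i\<close>; its own term, moved to the right, is the
  last product.\<close>

lemma lagrange_pole:
  fixes x :: "'i \<Rightarrow> 'a :: field"
  assumes fin: "finite I" and inj: "inj_on x I" and nz: "\<And>i. i \<in> I \<Longrightarrow> x i \<noteq> 0"
    and c: "c \<noteq> 0" "\<And>i. i \<in> I \<Longrightarrow> c * x i \<noteq> 1"
  shows "(\<Sum>i\<in>I. (\<Prod>j\<in>I. 1 - \<alpha> j * x i) * ((1 - b * x i) / (1 - c * x i)) / (\<Prod>j\<in>I-{i}. 1 - x i / x j)) =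
         1 - b / c * (\<Prod>j\<in>I. \<alpha> j * x j) - (1 - b / c) * (\<Prod>j\<in>I. (1 - \<alpha> j / c) / (1 - 1 / (c * x j)))"
proof -
  define y where "y = case_option (1 / c) x"
  define \<beta> where "\<beta> = case_option b \<alpha>"
  let ?J = "insert None (Some ` I)"
  have "inj_on y ?J"
    using inj c by (auto simp: inj_on_def y_def field_simps)
  moreover have "y i \<noteq> 0" if "i \<in> ?J" for i
    using that nz c by (auto simp: y_def)
  ultimately have "(\<Sum>i\<in>?J. (\<Prod>j\<in>?J. 1 - \<beta> j * y i) / (\<Prod>j\<in>?J-{i}. 1 - y i / y j)) = 1 - (\<Prod>j\<in>?J. \<beta> j * y j)"
    using fin by (intro lagrange_prod) auto
  moreover have "?J - {Some i} = insert None (Some ` (I - {i}))" "?J - {None} = Some ` I" for i by auto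
  ultimately have "(1 - b / c) * (\<Prod>j\<in>I. 1 - \<alpha> j / c) / (\<Prod>j\<in>I. 1 - 1 / (c * x j)) +
     (\<Sum>i\<in>I. (1 - b * x i) * (\<Prod>j\<in>I. 1 - \<alpha> j * x i) / ((1 - c * x i) * (\<Prod>j\<in>I-{i}. 1 - x i / x j))) =
     1 - b / c * (\<Prod>j\<in>I. \<alpha> j * x j)"
    using fin by (simp add: sum.reindex prod.reindex y_def \<beta>_def mult.commute)
  thus ?thesis
    by (simp add: prod_dividef algebra_simps)
qed

text \<open>A combination of \<open>lagrange_prod\<close> with parameters \<open>1 / z j\<close> and
  \<open>lagrange_pole\<close> with parameters \<open>a j / z j\<close>. The multiplier
  \<open>c / ((\<Prod>j\<in>I. a j) * b)\<close> is the one for which the products of all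
  \<open>x j / z j\<close> cancel; this is where the argument of Milne's series comes from.\<close>

lemma qgauss_interpolation:
  fixes x z a :: "'i \<Rightarrow> 'a :: field"
  assumes fin: "finite I" and inj: "inj_on x I" and nz: "\<And>i. i \<in> I \<Longrightarrow> x i \<noteq> 0"
    and c: "c \<noteq> 0" "\<And>i. i \<in> I \<Longrightarrow> c * x i \<noteq> 1"
    and nz': "\<And>i. i \<in> I \<Longrightarrow> z i \<noteq> 0" "\<And>i. i \<in> I \<Longrightarrow> a i \<noteq> 0" "b \<noteq> 0"
  shows "(\<Sum>i\<in>I. ((\<Prod>j\<in>I. 1 - x i / z j) - c / ((\<Prod>j\<in>I. a j) * b) * (\<Prod>j\<in>I. 1 - a j * x i / z j) *
            ((1 - b * x i) / (1 - c * x i))) / (\<Prod>j\<in>I-{i}. 1 - x i / x j)) =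
         1 - c / ((\<Prod>j\<in>I. a j) * b) - (1 - c / b) * (\<Prod>j\<in>I. x j / z j * ((1 - c * z j / a j) / (1 - c * x j)))"
proof -
  define A where "A = (\<Prod>j\<in>I. a j)"
  define X where "X = (\<Prod>j\<in>I. x j / z j)"
  define R where "R = (\<Prod>j\<in>I. x j / z j * ((1 - c * z j / a j) / (1 - c * x j)))"
  have A: "A \<noteq> 0" using fin nz' by (simp add: A_def)
  have 1: "(\<Sum>i\<in>I. (\<Prod>j\<in>I. 1 - x i / z j) / (\<Prod>j\<in>I-{i}. 1 - x i / x j)) = 1 - X"
    using lagrange_prod[OF fin inj nz, of "\<lambda>j. 1 / z j"] by (simp add: X_def)
  have "(\<Prod>j\<in>I. a j / z j * x j) = A * X"
    by (simp add: A_def X_def flip: prod.distrib)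
  moreover have "(\<Prod>j\<in>I. (1 - a j / z j / c) / (1 - 1 / (c * x j))) = A * R"
    unfolding A_def R_def prod.distrib[symmetric]
  proof (intro prod.cong refl)
    fix j assume "j \<in> I"
    hence "x j \<noteq> 0" "z j \<noteq> 0" "a j \<noteq> 0" "c * x j \<noteq> 1" using nz nz' c by auto
    moreover from this have "1 - c * x j \<noteq> 0" "c * x j - 1 \<noteq> 0" by auto
    ultimately show "(1 - a j / z j / c) / (1 - 1 / (c * x j)) = a j * (x j / z j * ((1 - c * z j / a j) / (1 - c * x j)))"
      using c(1) by (simp add: divide_simps) (simp add: algebra_simps)
  qed
  ultimately have 2: "(\<Sum>i\<in>I. (\<Prod>j\<in>I. 1 - a j * x i / z j) * ((1 - b * x i) / (1 - c * x i)) / (\<Prod>j\<in>I-{i}. 1 - x i / x j)) =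
      1 - b / c * (A * X) - (1 - b / c) * (A * R)"
    using lagrange_pole[OF fin inj nz c, of "\<lambda>j. a j / z j" b] by simp
  have "(\<Sum>i\<in>I. ((\<Prod>j\<in>I. 1 - x i / z j) - c / (A * b) * (\<Prod>j\<in>I. 1 - a j * x i / z j) *
            ((1 - b * x i) / (1 - c * x i))) / (\<Prod>j\<in>I-{i}. 1 - x i / x j)) =
        (1 - X) - c / (A * b) * (1 - b / c * (A * X) - (1 - b / c) * (A * R))"
    unfolding 1[symmetric] 2[symmetric] sum_distrib_left sum_subtractf[symmetric]
    by (intro sum.cong refl) (simp add: diff_divide_distrib mult.assoc)
  also have "\<dots> = 1 - c / (A * b) - (1 - c / b) * R"
    using A c nz' by (simp add: field_simps)
  finally show ?thesis by (simp only: A_def R_def)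
qed

section \<open>Sums over finitely supported exponents\<close>

text \<open>The value off \<open>A\<close> is 0 instead of \<open>undefined\<close>, so that the
  last column of a matrix in \<open>strict_upper_mats\<close> belongs to such a set as it
  stands.\<close>

definition supp_on :: "'a set \<Rightarrow> ('a \<Rightarrow> nat) set" where
  "supp_on A = {m. \<forall>a. m a \<noteq> 0 \<longrightarrow> a \<in> A}"

text \<open>A finite set of exponents lies in a box, over which the sum factors into finite
  geometric sums; the resulting bound is independent of the box.\<close>

lemma summable_power_sum_supp_on:
  fixes r :: real
  assumes "finite A" "0 \<le> r" "r < 1"
  shows "(\<lambda>m. r ^ (\<Sum>a\<in>A. m a)) summable_on supp_on A"
proof (rule nonneg_bounded_partial_sums_imp_summable_on)
  show "\<forall>\<^sub>F X in finite_subsets_at_top (supp_on A).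
          (\<Sum>m\<in>X. r ^ (\<Sum>a\<in>A. m a)) \<le> (\<Prod>a\<in>A. 1 / (1 - r))"
  proof (rule eventually_finite_subsets_at_top_weakI)
    fix X assume X: "finite X" "X \<subseteq> supp_on A"
    define M where "M = (\<Sum>m\<in>X. \<Sum>a\<in>A. m a)"
    have le_M: "m a \<le> M" if "m \<in> X" "a \<in> A" for m a
    proof -
      have "m a \<le> (\<Sum>a\<in>A. m a)" using that assms by (intro member_le_sum) auto
      also have "\<dots> \<le> M" unfolding M_def using that X by (intro member_le_sum) auto
      finally show ?thesis .
    qed
    have inj: "inj_on (\<lambda>m. restrict m A) X"
    proof (rule inj_onI)
      fix m m' assume "m \<in> X" "m' \<in> X" and eq: "restrict m A = restrict m' A"
      hence "m \<in> supp_on A" "m' \<in> supp_on A" using X by auto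
      show "m = m'"
      proof
        fix a
        have "m a = 0 \<and> m' a = 0" if "a \<notin> A"
          using that \<open>m \<in> supp_on A\<close> \<open>m' \<in> supp_on A\<close> unfolding supp_on_def by blast
        thus "m a = m' a"
          using fun_cong[OF eq, of a] by (cases "a \<in> A") auto
      qed
    qed
    have "(\<Sum>m\<in>X. r ^ (\<Sum>a\<in>A. m a)) = (\<Sum>m\<in>X. \<Prod>a\<in>A. r ^ (restrict m A) a)"
      by (simp add: power_sum)
    also have "\<dots> = (\<Sum>g\<in>(\<lambda>m. restrict m A) ` X. \<Prod>a\<in>A. r ^ g a)"
      by (simp add: sum.reindex[OF inj])
    also have "\<dots> \<le> (\<Sum>g\<in>PiE A (\<lambda>_. {..M}). \<Prod>a\<in>A. r ^ g a)"
      using assms le_M by (intro sum_mono2 finite_PiE prod_nonneg) auto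
    also have "\<dots> = (\<Prod>a\<in>A. \<Sum>k\<le>M. r ^ k)"
      using assms by (subst prod_sum_PiE) auto
    also have "\<dots> \<le> (\<Prod>a\<in>A. 1 / (1 - r))"
      using assms sum_power_inj_le[of r "{..M}" "\<lambda>k. k"] by (intro prod_mono) (auto intro!: sum_nonneg)
    finally show "(\<Sum>m\<in>X. r ^ (\<Sum>a\<in>A. m a)) \<le> (\<Prod>a\<in>A. 1 / (1 - r))" .
  qed
qed (use assms in auto)

lemma has_sum_sum:
  fixes f :: "'i \<Rightarrow> 'a \<Rightarrow> 'b :: topological_comm_monoid_add"
  assumes "finite I" "\<And>i. i \<in> I \<Longrightarrow> (f i has_sum S i) A"
  shows "((\<lambda>m. \<Sum>i\<in>I. f i m) has_sum (\<Sum>i\<in>I. S i)) A"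
  using assms by (induction rule: finite_induct) (auto intro: has_sum_add)

lemma has_sum_diff:
  fixes f g :: "'a \<Rightarrow> 'b :: topological_ab_group_add"
  assumes "(f has_sum S) A" "(g has_sum T) A"
  shows "((\<lambda>m. f m - g m) has_sum (S - T)) A"
  using has_sum_add[OF assms(1), of "\<lambda>m. - g m" "- T"] assms(2) by (simp add: has_sum_uminus)

section \<open>Products over unordered pairs\<close>

definition pairs :: "'a :: linorder set \<Rightarrow> ('a \<times> 'a) set" where
  "pairs I = {(i, j). i \<in> I \<and> j \<in> I \<and> i < j}"

lemma finite_pairs [simp]: "finite I \<Longrightarrow> finite (pairs I)"
  by (rule finite_subset[of _ "I \<times> I"]) (auto simp: pairs_def)

text \<open>Isolates the factors that involve \<open>k\<close>, for use when only one node moves.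
  Symmetry of \<open>f\<close> allows the pair of \<open>k\<close> and \<open>j\<close> to be
  ordered by \<open>min\<close> and \<open>max\<close>.\<close>

lemma prod_pairs_remove:
  assumes "finite I" "k \<in> I" "\<And>i j. f i j = f j i"
  shows "(\<Prod>(i, j)\<in>pairs I. f i j) = (\<Prod>j\<in>I-{k}. f k j) * (\<Prod>(i, j)\<in>pairs (I - {k}). f i j)"
proof -
  let ?h = "\<lambda>j. (min k j, max k j)"
  have "pairs I = ?h ` (I - {k}) \<union> pairs (I - {k})"
  proof (intro equalityI subsetI)
    fix p assume p: "p \<in> pairs I"
    consider "fst p = k" | "snd p = k" | "fst p \<noteq> k" "snd p \<noteq> k" by blast
    thus "p \<in> ?h ` (I - {k}) \<union> pairs (I - {k})"
    proof cases
      case 1 with p show ?thesis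
        by (intro UnI1 image_eqI[of _ _ "snd p"]) (auto simp: pairs_def min_def max_def)
    next
      case 2 with p show ?thesis
        by (intro UnI1 image_eqI[of _ _ "fst p"]) (auto simp: pairs_def min_def max_def)
    qed (use p in \<open>auto simp: pairs_def\<close>)
  qed (use assms in \<open>auto simp: pairs_def min_def max_def\<close>)
  moreover have "?h ` (I - {k}) \<inter> pairs (I - {k}) = {}"
    by (auto simp: pairs_def min_def max_def split: if_splits)
  moreover have "inj_on ?h (I - {k})"
    by (auto simp: inj_on_def min_def max_def split: if_splits)
  moreover have "(case ?h j of (i, j) \<Rightarrow> f i j) = f k j" for j
    using assms(3)[of j k] by (simp add: min_def max_def)
  ultimately show ?thesis
    using assms(1) by (simp add: prod.union_disjoint prod.reindex)
qed

section \<open>The q-Gauss sum of type A\<close>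

text \<open>\<open>c\<close> is not a parameter of the locale, because the proof moves it through
  the values \<open>q ^ K * c\<close>.\<close>

locale qgauss_An =
  fixes q :: complex and I :: "nat set" and z a :: "nat \<Rightarrow> complex" and b :: complex
  assumes q: "q \<noteq> 0" "norm q < 1" and fin: "finite I"
    and z_nz: "\<And>i. i \<in> I \<Longrightarrow> z i \<noteq> 0" and a_nz: "\<And>i. i \<in> I \<Longrightarrow> a i \<noteq> 0" and b_nz: "b \<noteq> 0"
    and generic: "\<And>i j k. i \<in> I \<Longrightarrow> j \<in> I \<Longrightarrow> i \<noteq> j \<Longrightarrow> z i \<noteq> q powi k * z j"
begin

definition node :: "(nat \<Rightarrow> nat) \<Rightarrow> nat \<Rightarrow> complex" where
  "node m i = q ^ m i * z i"

text \<open>The Vandermonde product of the nodes divided by that of the \<open>z i\<close>,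
  restricted to the indices in \<open>J\<close>.\<close>

definition vand :: "nat set \<Rightarrow> (nat \<Rightarrow> nat) \<Rightarrow> complex" where
  "vand J m = (\<Prod>(i, j)\<in>pairs J. (node m i - node m j) / (z i - z j))"

definition weight :: "complex \<Rightarrow> nat \<Rightarrow> nat \<Rightarrow> complex" where
  "weight c i p = (\<Prod>j\<in>I. qpoch (a j * z i / z j) q p / qpoch (q * z i / z j) q p) *
     (qpoch (b * z i) q p / qpoch (c * z i) q p)"

definition arg :: "complex \<Rightarrow> complex" where
  "arg c = c / ((\<Prod>j\<in>I. a j) * b)"

definition summand :: "complex \<Rightarrow> (nat \<Rightarrow> nat) \<Rightarrow> complex" where
  "summand c m = vand I m * (\<Prod>i\<in>I. weight c i (m i)) * arg c ^ (\<Sum>i\<in>I. m i)"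

text \<open>\<open>c \<noteq> 0\<close> makes \<open>1 / c\<close> available as an interpolation
  node. The second condition separates it from every possible node and says that no
  \<open>qpoch (c * z i) q p\<close> vanishes; ranging over all \<open>p\<close> makes it stable
  under \<open>c \<mapsto> q c\<close>.\<close>

definition admissible :: "complex \<Rightarrow> bool" where
  "admissible c \<longleftrightarrow> c \<noteq> 0 \<and> (\<forall>i\<in>I. \<forall>p. q ^ p * (c * z i) \<noteq> 1)"

lemma admissible_mult: "admissible c \<Longrightarrow> admissible (q * c)"
  using q unfolding admissible_def by (metis mult.assoc mult_eq_0_iff power_Suc2)

lemma admissible_power: "admissible c \<Longrightarrow> admissible (q ^ K * c)"
  by (induction K) (auto simp: admissible_mult mult.assoc)

lemma admissible_pole: "admissible c \<Longrightarrow> i \<in> I \<Longrightarrow> c * node m i \<noteq> 1"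
  unfolding admissible_def node_def by (simp add: mult_ac)

lemma admissible_pole': "admissible c \<Longrightarrow> i \<in> I \<Longrightarrow> c * z i \<noteq> 1"
  unfolding admissible_def by (metis mult_1 power_0)

lemma node_nz: "i \<in> I \<Longrightarrow> node m i \<noteq> 0"
  using q z_nz by (simp add: node_def)

lemma node_generic:
  assumes "i \<in> I" "j \<in> I" "i \<noteq> j"
  shows "q ^ k * node m i \<noteq> node m j"
proof
  assume *: "q ^ k * node m i = node m j"
  have "z i = q powi (int (m j) - int (m i + k)) * z j"
    using * q by (simp add: node_def power_int_diff power_add field_simps flip: of_nat_add)
  thus False using generic[OF assms] by blast
qed

lemma node_neq: "i \<in> I \<Longrightarrow> j \<in> I \<Longrightarrow> i \<noteq> j \<Longrightarrow> node m i \<noteq> node m j"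
  using node_generic[of i j 0] by simp

lemma z_neq: "i \<in> I \<Longrightarrow> j \<in> I \<Longrightarrow> i \<noteq> j \<Longrightarrow> z i \<noteq> z j"
  using generic[of i j 0] by simp

lemma node_inj: "inj_on (node m) I"
  using node_neq by (auto simp: inj_on_def)

lemma lower_nz: "i \<in> I \<Longrightarrow> j \<in> I \<Longrightarrow> q ^ p * (q * z i / z j) \<noteq> 1"
proof
  assume ij: "i \<in> I" "j \<in> I" and *: "q ^ p * (q * z i / z j) = 1"
  show False
  proof (cases "i = j")
    case True
    hence "q ^ Suc p = 1" using * z_nz ij by (simp add: mult_ac)
    hence "norm q ^ Suc p = 1" by (metis norm_one norm_power)
    moreover have "norm q ^ Suc p < 1" using q(2) by (intro power_Suc_less_one) (use q in auto)
    ultimately show False by simp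
  next
    case False
    have "q ^ Suc p * node (\<lambda>_. 0) i = node (\<lambda>_. 0) j" using * z_nz ij by (simp add: node_def field_simps)
    thus False using node_generic[OF ij False] by blast
  qed
qed

lemma vand_remove:
  assumes "k \<in> I"
  shows "vand I m = (\<Prod>j\<in>I-{k}. (node m k - node m j) / (z k - z j)) * vand (I - {k}) m"
  unfolding vand_def
proof (rule prod_pairs_remove[OF fin assms])
  show "(node m i - node m j) / (z i - z j) = (node m j - node m i) / (z j - z i)" for i j
    by (metis minus_diff_eq minus_divide_divide)
qed

lemma node_upd: "node (m(i := Suc (m i))) j = (if j = i then q * node m i else node m j)"
  by (simp add: node_def)

text \<open>Only the pairs containing \<open>i\<close> change, and
  \<open>(x - node m j) / (1 - x / node m j) = - node m j\<close> does not depend on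
  \<open>x\<close>; hence replacing \<open>x = node m i\<close> by \<open>q * node m i\<close> has
  no effect.\<close>

lemma vand_Suc:
  assumes "i \<in> I"
  shows "vand I (m(i := Suc (m i))) / (\<Prod>j\<in>I-{i}. 1 - q * node m i / node m j) =
         vand I m / (\<Prod>j\<in>I-{i}. 1 - node m i / node m j)"
proof -
  have "vand (I - {i}) (m(i := Suc (m i))) = vand (I - {i}) m"
    unfolding vand_def by (intro prod.cong refl) (auto simp: pairs_def node_upd)
  moreover have "(\<Prod>j\<in>I-{i}. (q * node m i - node m j) / (z i - z j)) / (\<Prod>j\<in>I-{i}. 1 - q * node m i / node m j) =
      (\<Prod>j\<in>I-{i}. (node m i - node m j) / (z i - z j)) / (\<Prod>j\<in>I-{i}. 1 - node m i / node m j)"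
    unfolding prod_dividef[symmetric]
  proof (intro prod.cong refl)
    fix j assume "j \<in> I - {i}"
    hence "q * node m i \<noteq> node m j" "node m i \<noteq> node m j" "node m j \<noteq> 0" "z i \<noteq> z j"
      using node_generic[of i j 1 m] node_neq[of i j m] z_neq[of i j] node_nz assms by auto
    thus "(q * node m i - node m j) / (z i - z j) / (1 - q * node m i / node m j) =
          (node m i - node m j) / (z i - z j) / (1 - node m i / node m j)"
      by (simp add: divide_simps) (simp add: algebra_simps)
  qed
  moreover have "(\<Prod>j\<in>I-{i}. (node (m(i := Suc (m i))) i - node (m(i := Suc (m i))) j) / (z i - z j)) =
      (\<Prod>j\<in>I-{i}. (q * node m i - node m j) / (z i - z j))"
    by (intro prod.cong refl) (auto simp: node_upd)
  ultimately show ?thesis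
    unfolding vand_remove[OF assms] times_divide_eq_left[symmetric] by simp
qed

text \<open>The product on the left is what the numerator of \<open>cert\<close> turns into after
  the step; it cancels the new factors of the denominators
  \<open>qpoch (q * z i / z j)\<close>.\<close>

lemma weight_Suc:
  assumes "i \<in> I"
  shows "weight c i (Suc (m i)) * (\<Prod>j\<in>I. 1 - q * node m i / z j) =
    weight c i (m i) * (\<Prod>j\<in>I. 1 - a j * node m i / z j) * ((1 - b * node m i) / (1 - c * node m i))"
proof -
  have "(\<Prod>j\<in>I. qpoch (a j * z i / z j) q (Suc (m i)) / qpoch (q * z i / z j) q (Suc (m i))) *
        (\<Prod>j\<in>I. 1 - q * node m i / z j) =
        (\<Prod>j\<in>I. qpoch (a j * z i / z j) q (m i) / qpoch (q * z i / z j) q (m i)) *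
        (\<Prod>j\<in>I. 1 - a j * node m i / z j)"
    unfolding prod.distrib[symmetric]
  proof (intro prod.cong refl)
    fix j assume "j \<in> I"
    hence "q ^ m i * (q * z i / z j) \<noteq> 1" using lower_nz assms by blast
    moreover have x_eq: "w * node m i / z j = q ^ m i * (w * z i / z j)" for w
      by (simp add: node_def)
    ultimately show "qpoch (a j * z i / z j) q (Suc (m i)) / qpoch (q * z i / z j) q (Suc (m i)) * (1 - q * node m i / z j) =
          qpoch (a j * z i / z j) q (m i) / qpoch (q * z i / z j) q (m i) * (1 - a j * node m i / z j)"
      unfolding qpoch_Suc x_eq by simp
  qed
  moreover have "qpoch (b * z i) q (Suc (m i)) / qpoch (c * z i) q (Suc (m i)) =
     qpoch (b * z i) q (m i) / qpoch (c * z i) q (m i) * ((1 - b * node m i) / (1 - c * node m i))"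
    by (simp add: qpoch_Suc node_def mult_ac)
  ultimately show ?thesis unfolding weight_def by algebra
qed

text \<open>
  The rational certificate that makes the contiguous relation under \<open>c \<mapsto> q c\<close> telescope. After
  division by \<open>summand c m\<close> the relation is Lagrange interpolation at \<open>0\<close> with nodes \<open>node m i\<close>
  and \<open>1 / c\<close>, which is \<open>qgauss_interpolation\<close>.
\<close>

definition cert :: "complex \<Rightarrow> nat \<Rightarrow> (nat \<Rightarrow> nat) \<Rightarrow> complex" where
  "cert c i m = summand c m * ((\<Prod>j\<in>I. 1 - node m i / z j) / (\<Prod>j\<in>I-{i}. 1 - node m i / node m j))"

lemma cert_Suc:
  assumes "i \<in> I"
  shows "cert c i (m(i := Suc (m i))) = summand c m *
    (arg c * (\<Prod>j\<in>I. 1 - a j * node m i / z j) * ((1 - b * node m i) / (1 - c * node m i)) /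
      (\<Prod>j\<in>I-{i}. 1 - node m i / node m j))"
proof -
  let ?m = "m(i := Suc (m i))"
  define W where "W = (\<Prod>j\<in>I-{i}. weight c j (m j))"
  have W: "(\<Prod>j\<in>I. weight c j (?m j)) = weight c i (Suc (m i)) * W"
          "(\<Prod>j\<in>I. weight c j (m j)) = weight c i (m i) * W"
    using assms fin by (auto simp: W_def prod.remove[of I i])
  have S: "(\<Sum>j\<in>I. ?m j) = Suc (\<Sum>j\<in>I. m j)"
    using assms fin by (auto simp: sum.remove[of I i])
  define D where "D = (\<Prod>j\<in>I-{i}. 1 - q * node m i / node m j)"
  have "cert c i ?m = (vand I ?m / D) * (weight c i (Suc (m i)) * (\<Prod>j\<in>I. 1 - q * node m i / z j)) * W *
      arg c ^ Suc (\<Sum>j\<in>I. m j)"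
  proof -
    have "(\<Prod>j\<in>I-{i}. 1 - node ?m i / node ?m j) = D"
      unfolding D_def by (intro prod.cong refl) (auto simp: node_upd)
    thus ?thesis unfolding cert_def summand_def W S by (simp add: node_upd)
  qed
  also have "\<dots> = summand c m *
    (arg c * (\<Prod>j\<in>I. 1 - a j * node m i / z j) * ((1 - b * node m i) / (1 - c * node m i)) /
      (\<Prod>j\<in>I-{i}. 1 - node m i / node m j))"
    unfolding weight_Suc[OF assms] D_def vand_Suc[OF assms] summand_def W by (simp add: mult_ac)
  finally show ?thesis .
qed

text \<open>\<open>c\<close> enters only through the denominators \<open>qpoch (c * z i)\<close>,
  which change by the two boundary factors of \<open>qpoch_shift\<close>, and through the argument,
  which yields the powers \<open>q ^ m i\<close>.\<close>

lemma summand_shift: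
  assumes "admissible c"
  shows "summand (q * c) m = summand c m * (\<Prod>i\<in>I. q ^ m i * ((1 - c * z i) / (1 - c * node m i)))"
proof -
  have w: "weight (q * c) i (m i) = weight c i (m i) * ((1 - c * z i) / (1 - c * node m i))" if "i \<in> I" for i
  proof -
    have "qpoch (c * z i) q (m i) * (1 - c * node m i) = (1 - c * z i) * qpoch (q * c * z i) q (m i)"
      using qpoch_shift[of "c * z i" q "m i"] by (simp add: node_def mult_ac)
    moreover have "1 - c * node m i \<noteq> 0" "1 - c * z i \<noteq> 0"
      using admissible_pole[OF assms that] admissible_pole'[OF assms that] by auto
    ultimately have "1 / qpoch (q * c * z i) q (m i) = 1 / qpoch (c * z i) q (m i) * ((1 - c * z i) / (1 - c * node m i))"
      by (cases "qpoch (c * z i) q (m i) = 0") (auto simp: divide_simps mult_ac)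
    thus ?thesis
      by (simp add: weight_def divide_inverse mult_ac)
  qed
  have "arg (q * c) ^ (\<Sum>i\<in>I. m i) = arg c ^ (\<Sum>i\<in>I. m i) * (\<Prod>i\<in>I. q ^ m i)"
    by (simp add: arg_def power_mult_distrib power_divide flip: power_sum)
  moreover have "(\<Prod>i\<in>I. weight (q * c) i (m i)) =
      (\<Prod>i\<in>I. weight c i (m i)) * (\<Prod>i\<in>I. (1 - c * z i) / (1 - c * node m i))"
    unfolding prod.distrib[symmetric] by (intro prod.cong refl w)
  ultimately show ?thesis
    unfolding summand_def prod.distrib by simp
qed

lemma summand_telescope:
  assumes "admissible c"
  shows "(1 - arg c) * summand c m -
         (1 - c / b) * (\<Prod>i\<in>I. (1 - c * z i / a i) / (1 - c * z i)) * summand (q * c) m =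
         (\<Sum>i\<in>I. cert c i m - cert c i (m(i := Suc (m i))))"
proof -
  have c: "c \<noteq> 0" using assms by (simp add: admissible_def)
  define R where "R = (\<Prod>j\<in>I. node m j / z j * ((1 - c * z j / a j) / (1 - c * node m j)))"
  have "(\<Sum>i\<in>I. cert c i m - cert c i (m(i := Suc (m i)))) =
    summand c m * (\<Sum>i\<in>I. ((\<Prod>j\<in>I. 1 - node m i / z j) - arg c * (\<Prod>j\<in>I. 1 - a j * node m i / z j) *
            ((1 - b * node m i) / (1 - c * node m i))) / (\<Prod>j\<in>I-{i}. 1 - node m i / node m j))"
    unfolding sum_distrib_left
    by (intro sum.cong refl) (simp add: cert_Suc, simp add: cert_def diff_divide_distrib right_diff_distrib)
  also have "\<dots> = summand c m * (1 - arg c - (1 - c / b) * R)"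
    unfolding arg_def R_def
    using qgauss_interpolation[OF fin node_inj node_nz c admissible_pole[OF assms] z_nz a_nz b_nz] by simp
  \<comment> \<open>Since \<open>node m i / z i = q ^ m i\<close>, the term \<open>R\<close> left
    over by the interpolation is the ratio of the summands for \<open>q * c\<close> and
    \<open>c\<close>, up to factors free of \<open>m\<close>.\<close>
  also have "summand c m * R =
     (\<Prod>i\<in>I. (1 - c * z i / a i) / (1 - c * z i)) * summand (q * c) m"
  proof -
    have R: "R = (\<Prod>i\<in>I. (1 - c * z i / a i) / (1 - c * z i)) *
        (\<Prod>i\<in>I. q ^ m i * ((1 - c * z i) / (1 - c * node m i)))"
      unfolding R_def prod.distrib[symmetric] using z_nz admissible_pole'[OF assms]
      by (intro prod.cong refl) (auto simp: node_def)
    show ?thesis unfolding summand_shift[OF assms] R by (simp only: mult_ac)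
  qed
  ultimately show ?thesis by (simp add: algebra_simps)
qed

section \<open>Bounds for the summand and the certificate\<close>

lemma norm_node_le: "norm (node m i) \<le> norm (z i)"
proof -
  have "norm q ^ m i * norm (z i) \<le> 1 * norm (z i)"
    using q by (intro mult_right_mono power_le_one) auto
  thus ?thesis by (simp add: node_def norm_mult norm_power)
qed

lemma vand_bounded: "J \<subseteq> I \<Longrightarrow> \<exists>C. \<forall>m. norm (vand J m) \<le> C"
  unfolding vand_def case_prod_unfold
proof (rule bounded_prod)
  fix ij
  have "norm ((node m (fst ij) - node m (snd ij)) / (z (fst ij) - z (snd ij)))
      \<le> (norm (z (fst ij)) + norm (z (snd ij))) / norm (z (fst ij) - z (snd ij))" for m
    unfolding norm_divide
    by (intro divide_right_mono order_trans[OF norm_triangle_ineq4] add_mono norm_node_le) auto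
  thus "\<exists>C. \<forall>m. norm ((node m (fst ij) - node m (snd ij)) / (z (fst ij) - z (snd ij))) \<le> C" by blast
qed (blast intro: finite_pairs finite_subset[OF _ fin])

text \<open>The parameter is a pair of \<open>K\<close> and \<open>m\<close>, because the limit
  \<open>K \<rightarrow> \<infinity>\<close> requires one constant for all \<open>K\<close>.\<close>

lemma weights_bounded:
  assumes "admissible c"
  shows "\<exists>C. \<forall>Km. norm (\<Prod>i\<in>I. weight (q ^ fst Km * c) i (snd Km i)) \<le> C"
proof (rule bounded_prod[OF fin])
  fix i assume i: "i \<in> I"
  show "\<exists>C. \<forall>Km :: nat \<times> (nat \<Rightarrow> nat). norm (weight (q ^ fst Km * c) i (snd Km i)) \<le> C"
    unfolding weight_def divide_inverse
  proof (intro bounded_mult bounded_prod fin)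
    fix j assume j: "j \<in> I"
    show "\<exists>C. \<forall>Km :: nat \<times> (nat \<Rightarrow> nat). norm (qpoch (a j * z i * inverse (z j)) q (snd Km i)) \<le> C"
      using qpoch_bounded[OF q(2)] by blast
    show "\<exists>C. \<forall>Km :: nat \<times> (nat \<Rightarrow> nat). norm (inverse (qpoch (q * z i * inverse (z j)) q (snd Km i))) \<le> C"
      using inverse_qpoch_bounded[OF q(2) lower_nz[OF i j]] unfolding divide_inverse
      by (metis mult_1 power_0)
  next
    show "\<exists>C. \<forall>Km :: nat \<times> (nat \<Rightarrow> nat). norm (qpoch (b * z i) q (snd Km i)) \<le> C"
      using qpoch_bounded[OF q(2)] by blast
    have "q ^ p * (c * z i) \<noteq> 1" for p using assms i by (auto simp: admissible_def)
    from inverse_qpoch_bounded[OF q(2) this]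
    show "\<exists>C. \<forall>Km :: nat \<times> (nat \<Rightarrow> nat). norm (inverse (qpoch (q ^ fst Km * c * z i) q (snd Km i))) \<le> C"
      unfolding mult.assoc by blast
  qed
qed

lemma summand_bound:
  assumes "admissible c"
  obtains C where "\<And>K m. norm (summand (q ^ K * c) m) \<le> C * norm (arg (q ^ K * c)) ^ (\<Sum>i\<in>I. m i)"
proof -
  obtain C where "\<And>m. norm (vand I m) \<le> C" using vand_bounded by blast
  moreover obtain D where "\<And>K m. norm (\<Prod>i\<in>I. weight (q ^ K * c) i (m i)) \<le> D"
    using weights_bounded[OF assms] by auto
  ultimately have "norm (vand I m * (\<Prod>i\<in>I. weight (q ^ K * c) i (m i))) \<le> C * D" for K m
    unfolding norm_mult using norm_ge_zero order_trans by (intro mult_mono) blast+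
  hence "norm (summand (q ^ K * c) m) \<le> C * D * norm (arg (q ^ K * c)) ^ (\<Sum>i\<in>I. m i)" for K m
    unfolding summand_def norm_mult[of _ "arg _ ^ _"] norm_power by (intro mult_right_mono) auto
  thus ?thesis using that by blast
qed

text \<open>The denominators of \<open>cert\<close> cancel against the factors of
  \<open>vand\<close> that involve \<open>i\<close>. Apart from the weights and the power of
  \<open>arg c\<close>, what remains is polynomial in the nodes, hence bounded.\<close>

lemma cert_bound:
  assumes "admissible c" "i \<in> I"
  shows "\<exists>C. \<forall>m. norm (cert c i m) \<le> C * norm (arg c) ^ (\<Sum>i\<in>I. m i)"
proof -
  have fact: "(\<Prod>j\<in>I-{i}. (node m i - node m j) / (z i - z j)) / (\<Prod>j\<in>I-{i}. 1 - node m i / node m j) =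
      (\<Prod>j\<in>I-{i}. - node m j / (z i - z j))" for m
    unfolding prod_dividef[symmetric]
  proof (intro prod.cong refl)
    fix j assume "j \<in> I - {i}"
    hence "node m i \<noteq> node m j" "node m j \<noteq> 0" "z i \<noteq> z j"
      using node_neq[of i j m] z_neq[of i j] node_nz assms by auto
    thus "(node m i - node m j) / (z i - z j) / (1 - node m i / node m j) = - node m j / (z i - z j)"
      by (simp add: divide_simps) (simp add: algebra_simps)
  qed
  have eq: "cert c i m = vand (I - {i}) m * (\<Prod>j\<in>I. weight c j (m j)) *
      ((\<Prod>j\<in>I-{i}. - node m j / (z i - z j)) * (\<Prod>j\<in>I. 1 - node m i / z j)) * arg c ^ (\<Sum>i\<in>I. m i)" for m
    unfolding cert_def summand_def vand_remove[OF assms(2)] fact[symmetric] by simp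
  have "\<exists>C. \<forall>m. norm (vand (I - {i}) m * (\<Prod>j\<in>I. weight c j (m j)) *
      ((\<Prod>j\<in>I-{i}. - node m j / (z i - z j)) * (\<Prod>j\<in>I. 1 - node m i / z j))) \<le> C"
  proof (intro bounded_mult)
    show "\<exists>C. \<forall>m. norm (vand (I - {i}) m) \<le> C" by (rule vand_bounded) auto
    obtain C where "\<forall>Km. norm (\<Prod>i\<in>I. weight (q ^ fst Km * c) i (snd Km i)) \<le> C"
      using weights_bounded[OF assms(1)] by blast
    from spec[OF this, of "(0, _)"] show "\<exists>C. \<forall>m. norm (\<Prod>j\<in>I. weight c j (m j)) \<le> C"
      by auto
    show "\<exists>C. \<forall>m. norm (\<Prod>j\<in>I-{i}. - node m j / (z i - z j)) \<le> C"
    proof (intro bounded_prod)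
      fix j
      have "norm (- node m j / (z i - z j)) \<le> norm (z j) / norm (z i - z j)" for m
        unfolding norm_divide norm_minus_cancel by (intro divide_right_mono norm_node_le) auto
      thus "\<exists>C. \<forall>m. norm (- node m j / (z i - z j)) \<le> C" by blast
    qed (use fin in auto)
    show "\<exists>C. \<forall>m. norm (\<Prod>j\<in>I. 1 - node m i / z j) \<le> C"
    proof (intro bounded_prod fin)
      fix j
      have "norm (1 - node m i / z j) \<le> 1 + norm (z i) / norm (z j)" for m
        by (rule order_trans[OF norm_triangle_ineq4])
           (auto simp: norm_divide intro!: divide_right_mono norm_node_le)
      thus "\<exists>C. \<forall>m. norm (1 - node m i / z j) \<le> C" by blast
    qed
  qed
  then obtain C where C: "\<And>m. norm (vand (I - {i}) m * (\<Prod>j\<in>I. weight c j (m j)) *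
      ((\<Prod>j\<in>I-{i}. - node m j / (z i - z j)) * (\<Prod>j\<in>I. 1 - node m i / z j))) \<le> C" by blast
  have "norm (cert c i m) \<le> C * norm (arg c) ^ (\<Sum>i\<in>I. m i)" for m
    unfolding eq norm_mult[of _ "arg _ ^ _"] norm_power by (intro mult_right_mono C) auto
  thus ?thesis by blast
qed

lemma summable_of_bound:
  assumes "\<And>m. norm (f m) \<le> C * norm (arg c) ^ (\<Sum>i\<in>I. m i)" "norm (arg c) < 1"
  shows "(\<lambda>m. norm (f m)) summable_on supp_on I"
proof (rule Infinite_Sum.abs_summable_on_comparison_test')
  show "(\<lambda>m. C * norm (arg c) ^ (\<Sum>i\<in>I. m i)) summable_on supp_on I"
    using assms(2) fin by (intro summable_on_cmult_right summable_power_sum_supp_on) auto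
qed (use assms in auto)

lemma summand_summable:
  assumes "admissible c" "norm (arg c) < 1"
  shows "(\<lambda>m. norm (summand c m)) summable_on supp_on I"
proof -
  obtain C where "\<And>K m. norm (summand (q ^ K * c) m) \<le> C * norm (arg (q ^ K * c)) ^ (\<Sum>i\<in>I. m i)"
    using summand_bound[OF assms(1)] by metis
  from this[of 0] show ?thesis
    using assms by (intro summable_of_bound[where c = c and C = C]) auto
qed

text \<open>The step \<open>m i \<mapsto> m i + 1\<close> maps the index set bijectively onto the
  exponents with \<open>m i \<noteq> 0\<close>. There is no boundary term: for
  \<open>m i = 0\<close> the factor \<open>j = i\<close> in the numerator of \<open>cert\<close> is
  \<open>1 - z i / z i\<close>.\<close>

lemma cert_telescope:
  assumes "admissible c" "norm (arg c) < 1" "i \<in> I"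
  shows "((\<lambda>m. cert c i m - cert c i (m(i := Suc (m i)))) has_sum 0) (supp_on I)"
proof -
  let ?h = "\<lambda>m. m(i := Suc (m i))"
  obtain C where "\<And>m. norm (cert c i m) \<le> C * norm (arg c) ^ (\<Sum>i\<in>I. m i)"
    using cert_bound[OF assms(1,3)] by blast
  hence "cert c i summable_on supp_on I"
    by (rule abs_summable_summable[OF summable_of_bound[OF _ assms(2)]])
  hence S: "(cert c i has_sum infsum (cert c i) (supp_on I)) (supp_on I)"
    by (rule has_sum_infsum)
  have zero: "cert c i m = 0" if "m i = 0" for m
  proof -
    have "(\<Prod>j\<in>I. 1 - node m i / z j) = 0"
      using that fin assms z_nz by (intro prod_zero) (auto simp: node_def)
    thus ?thesis by (simp add: cert_def)
  qed
  have inj: "inj_on ?h (supp_on I)"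
  proof (rule inj_onI, rule ext)
    fix m m' j assume "?h m = ?h m'"
    from fun_cong[OF this, of j] show "m j = m' j" by (cases "j = i") auto
  qed
  have "?h ` supp_on I = {m \<in> supp_on I. m i \<noteq> 0}"
  proof (intro equalityI subsetI)
    fix m assume m: "m \<in> {m \<in> supp_on I. m i \<noteq> 0}"
    show "m \<in> ?h ` supp_on I"
      by (rule image_eqI[of _ _ "m(i := m i - 1)"]) (use m in \<open>auto simp: supp_on_def\<close>)
  qed (use assms in \<open>auto simp: supp_on_def split: if_splits\<close>)
  moreover have "(cert c i has_sum infsum (cert c i) (supp_on I)) (supp_on I) \<longleftrightarrow>
      (cert c i has_sum infsum (cert c i) (supp_on I)) {m \<in> supp_on I. m i \<noteq> 0}"
    by (rule has_sum_cong_neutral) (auto simp: zero)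
  ultimately have "((\<lambda>m. cert c i (?h m)) has_sum infsum (cert c i) (supp_on I)) (supp_on I)"
    using has_sum_reindex[OF inj, of "cert c i"] S by (simp add: o_def)
  from has_sum_diff[OF S this] show ?thesis by simp
qed

section \<open>The contiguous relation, its iteration and its limit\<close>

lemma arg_shift: "arg (q ^ K * c) = q ^ K * arg c"
  by (simp add: arg_def)

text \<open>Summing \<open>summand_telescope\<close> over all \<open>m\<close> kills the right-hand
  side. The relation is kept free of denominators so that iterating it merely builds up finite
  factorials.\<close>

lemma infsum_shift:
  assumes "admissible c" "norm (arg c) < 1"
  shows "(1 - arg c) * (\<Prod>i\<in>I. 1 - c * z i) * infsum (summand c) (supp_on I) =
         (1 - c / b) * (\<Prod>i\<in>I. 1 - c * z i / a i) * infsum (summand (q * c)) (supp_on I)"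
proof -
  have c': "admissible (q * c)" "norm (arg (q * c)) < 1"
  proof -
    have "norm q * norm (arg c) \<le> 1 * norm (arg c)" using q by (intro mult_right_mono) auto
    thus "norm (arg (q * c)) < 1" using assms(2) arg_shift[of 1 c] by (simp add: norm_mult)
  qed (use assms admissible_mult in auto)
  define P where "P = (\<Prod>i\<in>I. (1 - c * z i / a i) / (1 - c * z i))"
  have sum: "(summand d has_sum infsum (summand d) (supp_on I)) (supp_on I)"
    if "admissible d" "norm (arg d) < 1" for d
    by (rule has_sum_infsum[OF abs_summable_summable[OF summand_summable[OF that]]])
  have "((\<lambda>m. \<Sum>i\<in>I. cert c i m - cert c i (m(i := Suc (m i)))) has_sum (\<Sum>i\<in>I. 0)) (supp_on I)"
    by (rule has_sum_sum[OF fin cert_telescope[OF assms]])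
  moreover have "((\<lambda>m. (1 - arg c) * summand c m - (1 - c / b) * P * summand (q * c) m) has_sum
       (1 - arg c) * infsum (summand c) (supp_on I) - (1 - c / b) * P * infsum (summand (q * c)) (supp_on I))
       (supp_on I)"
    by (intro has_sum_diff has_sum_cmult_right sum assms c')
  ultimately have eq: "(1 - arg c) * infsum (summand c) (supp_on I) =
       (1 - c / b) * P * infsum (summand (q * c)) (supp_on I)"
    unfolding summand_telescope[OF assms(1), folded P_def] using has_sum_unique by fastforce
  have "P * (\<Prod>i\<in>I. 1 - c * z i) = (\<Prod>i\<in>I. 1 - c * z i / a i)"
    unfolding P_def prod.distrib[symmetric] using admissible_pole'[OF assms(1)]
    by (intro prod.cong refl) auto
  moreover have "r * Z * G = s * N * G'" if "P * Z = N" "r * G = s * P * G'" for P Z N G G' r s :: complex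
    using arg_cong[OF that(2), of "\<lambda>w. Z * w"] unfolding that(1)[symmetric] by (simp only: mult_ac)
  ultimately show ?thesis using eq by blast
qed

lemma infsum_iterate:
  assumes "admissible c" "norm (arg c) < 1"
  shows "qpoch (arg c) q K * (\<Prod>i\<in>I. qpoch (c * z i) q K) * infsum (summand c) (supp_on I) =
         qpoch (c / b) q K * (\<Prod>i\<in>I. qpoch (c * z i / a i) q K) * infsum (summand (q ^ K * c)) (supp_on I)"
proof (induction K)
  case (Suc K)
  have "norm (q ^ K * arg c) \<le> 1 * norm (arg c)"
    unfolding norm_mult norm_power using q by (intro mult_right_mono power_le_one) auto
  hence "norm (arg (q ^ K * c)) < 1" using assms(2) by (simp add: arg_shift)
  from infsum_shift[OF admissible_power[OF assms(1)] this]
  have 1: "(1 - q ^ K * arg c) * (\<Prod>i\<in>I. 1 - q ^ K * (c * z i)) * infsum (summand (q ^ K * c)) (supp_on I) =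
         (1 - q ^ K * (c / b)) * (\<Prod>i\<in>I. 1 - q ^ K * (c * z i / a i)) * infsum (summand (q ^ Suc K * c)) (supp_on I)"
    by (simp add: arg_shift mult.assoc)
  have "(A * r) * (Z * y) * G = (B * s) * (N * n) * H'"
    if "A * Z * G = B * N * H" "r * y * H = s * n * H'" for A B Z N G H H' r s y n :: complex
    using that by algebra
  thus ?case unfolding qpoch_Suc prod.distrib using Suc.IH 1 by blast
qed simp

text \<open>The term at \<open>m = 0\<close> equals 1. Every other term has degree at least 1, so it
  carries at least one factor \<open>norm q ^ K\<close>, and the rest of the series is at most
  \<open>norm q ^ K\<close> times a fixed convergent sum.\<close>

lemma infsum_tendsto_1:
  assumes "admissible c" "norm (arg c) < 1"
  shows "(\<lambda>K. infsum (summand (q ^ K * c)) (supp_on I)) \<longlonglongrightarrow> 1"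
proof -
  obtain C where C: "\<And>K m. norm (summand (q ^ K * c) m) \<le> C * norm (arg (q ^ K * c)) ^ (\<Sum>i\<in>I. m i)"
    using summand_bound[OF assms(1)] by metis
  define E where "E m = C * norm (arg c) ^ (\<Sum>i\<in>I. m i)" for m
  let ?F = "supp_on I - {\<lambda>_. 0}"
  have F: "supp_on I = insert (\<lambda>_. 0) ?F" by (auto simp: supp_on_def)
  have C0: "C \<ge> 0" using order_trans[OF norm_ge_zero C[of 0 "\<lambda>_. 0"]] by simp
  have sumE: "E summable_on ?F"
    unfolding E_def using assms fin
    by (intro summable_on_cmult_right summable_on_subset_banach[OF summable_power_sum_supp_on[of I "norm (arg c)"]]) auto
  have bound: "norm (infsum (summand (q ^ K * c)) (supp_on I) - 1) \<le> norm q ^ K * infsum E ?F" for K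
  proof -
    have le: "norm (summand (q ^ K * c) m) \<le> norm q ^ K * E m" if "m \<in> ?F" for m
    proof -
      have "\<exists>i\<in>I. m i \<noteq> 0" using that by (auto simp: supp_on_def fun_eq_iff)
      hence "(\<Sum>i\<in>I. m i) \<noteq> 0" using fin by auto
      hence "(norm q ^ K) ^ (\<Sum>i\<in>I. m i) \<le> norm q ^ K"
        using power_decreasing[of 1 "\<Sum>i\<in>I. m i" "norm q ^ K"] q by (simp add: power_le_one)
      hence "C * ((norm q ^ K) ^ (\<Sum>i\<in>I. m i) * norm (arg c) ^ (\<Sum>i\<in>I. m i)) \<le>
             C * (norm q ^ K * norm (arg c) ^ (\<Sum>i\<in>I. m i))"
        using C0 by (intro mult_left_mono mult_right_mono) auto
      thus ?thesis using C[of K m] unfolding E_def arg_shift norm_mult norm_power power_mult_distrib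
        by (simp only: mult_ac)
    qed
    have sumE': "(\<lambda>m. norm q ^ K * E m) summable_on ?F"
      by (intro summable_on_cmult_right sumE)
    have abs: "(\<lambda>m. norm (summand (q ^ K * c) m)) summable_on ?F"
      by (rule Infinite_Sum.abs_summable_on_comparison_test'[OF sumE' le])
    have "summand (q ^ K * c) (\<lambda>_. 0) = 1"
    proof -
      have "vand I (\<lambda>_. 0) = 1"
        unfolding vand_def using z_neq by (intro prod.neutral) (auto simp: pairs_def node_def)
      thus ?thesis by (simp add: summand_def weight_def)
    qed
    hence "infsum (summand (q ^ K * c)) (supp_on I) = 1 + infsum (summand (q ^ K * c)) ?F"
      by (subst F, subst infsum_insert) (use abs_summable_summable[OF abs] in auto)
    hence "norm (infsum (summand (q ^ K * c)) (supp_on I) - 1) = norm (infsum (summand (q ^ K * c)) ?F)"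
      by simp
    also have "\<dots> \<le> infsum (\<lambda>m. norm (summand (q ^ K * c) m)) ?F"
      by (rule norm_infsum_bound[OF abs])
    also have "\<dots> \<le> infsum (\<lambda>m. norm q ^ K * E m) ?F"
      by (intro infsum_mono abs sumE' le)
    also have "\<dots> = norm q ^ K * infsum E ?F"
      by (rule infsum_cmult_right') 
    finally show ?thesis .
  qed
  have "(\<lambda>K. norm q ^ K * infsum E ?F) \<longlonglongrightarrow> 0"
    using q by (intro tendsto_mult_left_zero LIMSEQ_power_zero) auto
  hence "(\<lambda>K. infsum (summand (q ^ K * c)) (supp_on I) - 1) \<longlonglongrightarrow> 0"
    by (rule Lim_null_comparison[rotated]) (use bound in auto)
  thus ?thesis by (simp add: LIM_zero_iff)
qed

text \<open>Both sides of \<open>infsum_iterate\<close> are compared in the limit. For a single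
  index with \<open>z i = 1\<close> the result is Heine's q-Gauss sum.\<close>

theorem infsum_summand:
  assumes "admissible c" "norm (arg c) < 1"
  shows "infsum (summand c) (supp_on I) =
    qpoch_inf (c / b) q / qpoch_inf (arg c) q * (\<Prod>i\<in>I. qpoch_inf (c * z i / a i) q / qpoch_inf (c * z i) q)"
proof -
  let ?G = "infsum (summand c) (supp_on I)"
  have "(\<lambda>K. qpoch (arg c) q K * (\<Prod>i\<in>I. qpoch (c * z i) q K) * ?G) \<longlonglongrightarrow>
        qpoch_inf (arg c) q * (\<Prod>i\<in>I. qpoch_inf (c * z i) q) * ?G"
    by (intro tendsto_intros qpoch_tendsto_inf q)
  moreover have "(\<lambda>K. qpoch (arg c) q K * (\<Prod>i\<in>I. qpoch (c * z i) q K) * ?G) \<longlonglongrightarrow>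
        qpoch_inf (c / b) q * (\<Prod>i\<in>I. qpoch_inf (c * z i / a i) q) * 1"
    unfolding infsum_iterate[OF assms]
    by (intro tendsto_mult tendsto_prod qpoch_tendsto_inf q infsum_tendsto_1 assms)
  ultimately have "qpoch_inf (arg c) q * (\<Prod>i\<in>I. qpoch_inf (c * z i) q) * ?G =
        qpoch_inf (c / b) q * (\<Prod>i\<in>I. qpoch_inf (c * z i / a i) q)"
    using LIMSEQ_unique by fastforce
  moreover have "qpoch_inf (arg c) q \<noteq> 0"
  proof (rule qpoch_inf_nonzero[OF q(2)])
    fix k
    have "norm (q ^ k * arg c) \<le> 1 * norm (arg c)"
      unfolding norm_mult norm_power using q by (intro mult_right_mono power_le_one) auto
    thus "q ^ k * arg c \<noteq> 1" using assms(2) by (metis mult_1 norm_one not_less)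
  qed
  moreover have "(\<Prod>i\<in>I. qpoch_inf (c * z i) q) \<noteq> 0"
    using assms(1) fin qpoch_inf_nonzero[OF q(2)] by (auto simp: admissible_def)
  ultimately show ?thesis
    by (simp add: prod_dividef field_simps)
qed

end

section \<open>Splitting products over index pairs\<close>

lemma pairs_atLeastAtMost: "pairs {1..n} = {(i, j). 1 \<le> i \<and> i < j \<and> j \<le> n}" for n :: nat
  by (auto simp: pairs_def)

text \<open>Together with \<open>prod_upper\<close> this brings the two products in the coefficient
  to the same index set, leaving a column and a diagonal that are matched with each other.\<close>

lemma prod_strict_upper:
  "(\<Prod>(i, j)\<in>{(i, j). 1 \<le> i \<and> i < j \<and> j \<le> k}. f i j) =
   (\<Prod>(i, j)\<in>pairs {1..<k}. f i j) * (\<Prod>i\<in>{1..<k}. f i k)" for k :: nat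
proof -
  have "{(i, j). 1 \<le> i \<and> i < j \<and> j \<le> k} = pairs {1..<k} \<union> (\<lambda>i. (i, k)) ` {1..<k}"
    by (auto simp: pairs_def)
  moreover have "pairs {1..<k} \<inter> (\<lambda>i. (i, k)) ` {1..<k} = {}" by (auto simp: pairs_def)
  ultimately show ?thesis
    by (simp add: prod.union_disjoint prod.reindex inj_on_def)
qed

lemma prod_upper:
  "(\<Prod>(i, j)\<in>{(i, j). 1 \<le> i \<and> i \<le> j \<and> j < k}. f i j) =
   (\<Prod>(i, j)\<in>pairs {1..<k}. f i j) * (\<Prod>i\<in>{1..<k}. f i i)" for k :: nat
proof -
  have "{(i, j). 1 \<le> i \<and> i \<le> j \<and> j < k} = pairs {1..<k} \<union> (\<lambda>i. (i, i)) ` {1..<k}"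
    by (auto simp: pairs_def)
  moreover have "pairs {1..<k} \<inter> (\<lambda>i. (i, i)) ` {1..<k} = {}" by (auto simp: pairs_def)
  ultimately show ?thesis
    by (simp add: prod.union_disjoint prod.reindex inj_on_def)
qed

text \<open>Reassembles the factors attached to (i, j) and (j, i), together with the diagonal ones,
  into the double product formed by the weights of the series.\<close>

lemma prod_square:
  assumes "finite I"
  shows "(\<Prod>i\<in>I. \<Prod>j\<in>I. f i j) = (\<Prod>(i, j)\<in>pairs I. f i j * f j i) * (\<Prod>i\<in>I. f i i)"
proof -
  have "I \<times> I = pairs I \<union> prod.swap ` pairs I \<union> (\<lambda>i. (i, i)) ` I"
    by (auto simp: pairs_def image_iff)
  moreover have "(pairs I \<union> prod.swap ` pairs I) \<inter> (\<lambda>i. (i, i)) ` I = {}"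
    "pairs I \<inter> prod.swap ` pairs I = {}" by (auto simp: pairs_def)
  moreover have "inj_on prod.swap (pairs I)" by (rule inj_on_subset[OF inj_swap subset_UNIV])
  ultimately have "(\<Prod>(i, j)\<in>I \<times> I. f i j) =
      (\<Prod>(i, j)\<in>pairs I. f i j) * (\<Prod>(i, j)\<in>pairs I. f j i) * (\<Prod>i\<in>I. f i i)"
    using assms by (simp add: prod.union_disjoint prod.reindex inj_on_def case_prod_unfold)
  thus ?thesis
    by (simp add: prod.cartesian_product case_prod_unfold prod.distrib)
qed

lemma prod_pairs_snd:
  "(\<Prod>(i, j)\<in>pairs {1..N}. g j) = (\<Prod>j=1..N. g j ^ (j - 1))" for N :: nat
proof -
  have "(\<Prod>(i, j)\<in>pairs {1..N}. g j) = (\<Prod>(j, i)\<in>Sigma {1..N} (\<lambda>j. {1..<j}). g j)"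
    by (rule prod.reindex_bij_witness[of _ prod.swap prod.swap]) (auto simp: pairs_def)
  also have "\<dots> = (\<Prod>j=1..N. \<Prod>i\<in>{1..<j}. g j)"
    by (subst prod.Sigma) auto
  finally show ?thesis by simp
qed

lemma power_int_sum:
  fixes t :: "'a :: field"
  assumes "t \<noteq> 0"
  shows "t powi (\<Sum>i\<in>I. e i) = (\<Prod>i\<in>I. t powi e i)"
  by (induction I rule: infinite_finite_induct) (use assms in \<open>auto simp: power_int_add\<close>)

section \<open>Absolute convergence\<close>

definition up_factor ::
  "nat \<Rightarrow> (nat \<Rightarrow> nat \<Rightarrow> nat) \<Rightarrow> (nat \<Rightarrow> complex) \<Rightarrow> complex \<Rightarrow> complex \<Rightarrow> nat \<Rightarrow> nat \<Rightarrow> nat \<Rightarrow> complex" where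
  "up_factor n \<theta> s q t k i j =
     qpoch (q powi tail_diff n \<theta> k i j * (t * s j / s i)) q (\<theta> i k) /
     qpoch (q powi tail_diff n \<theta> k i j * (q * s j / s i)) q (\<theta> i k)"

definition low_factor ::
  "nat \<Rightarrow> (nat \<Rightarrow> nat \<Rightarrow> nat) \<Rightarrow> (nat \<Rightarrow> complex) \<Rightarrow> complex \<Rightarrow> complex \<Rightarrow> nat \<Rightarrow> nat \<Rightarrow> nat \<Rightarrow> complex" where
  "low_factor n \<theta> s q t k i j =
     qpoch (q powi (- int (\<theta> j k) + tail_diff n \<theta> k i j) * (q * s j / (t * s i))) q (\<theta> i k) /
     qpoch (q powi (- int (\<theta> j k) + tail_diff n \<theta> k i j) * (s j / s i)) q (\<theta> i k)"

text \<open>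
  The pairing of factors is chosen so that in each product \<open>up_factor * low_factor\<close> the growth of
  the first factor is compensated by the decay of the second.
\<close>

lemma c_coeff_alt:
  "c_coeff n \<theta> s q t = (\<Prod>k=1..n.
     (\<Prod>(i, j)\<in>pairs {1..<k}. up_factor n \<theta> s q t k i j * low_factor n \<theta> s q t k i j) *
     (\<Prod>i\<in>{1..<k}. up_factor n \<theta> s q t k i k * low_factor n \<theta> s q t k i i))"
proof -
  have "c_coeff n \<theta> s q t = (\<Prod>k=2..n.
     (\<Prod>(i, j)\<in>pairs {1..<k}. up_factor n \<theta> s q t k i j * low_factor n \<theta> s q t k i j) *
     (\<Prod>i\<in>{1..<k}. up_factor n \<theta> s q t k i k * low_factor n \<theta> s q t k i i))"
    unfolding c_coeff_def up_factor_def[symmetric] low_factor_def[symmetric]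
      prod_strict_upper prod_upper prod.distrib[symmetric]
    by (intro prod.cong refl) (simp add: prod.distrib case_prod_unfold mult_ac)
  also have "\<dots> = (\<Prod>k=1..n.
     (\<Prod>(i, j)\<in>pairs {1..<k}. up_factor n \<theta> s q t k i j * low_factor n \<theta> s q t k i j) *
     (\<Prod>i\<in>{1..<k}. up_factor n \<theta> s q t k i k * low_factor n \<theta> s q t k i i))"
  proof (rule prod.mono_neutral_left)
    show "\<forall>k\<in>{1..n} - {2..n}. (\<Prod>(i, j)\<in>pairs {1..<k}. up_factor n \<theta> s q t k i j * low_factor n \<theta> s q t k i j) *
     (\<Prod>i\<in>{1..<k}. up_factor n \<theta> s q t k i k * low_factor n \<theta> s q t k i i) = 1"
    proof
      fix k assume "k \<in> {1..n} - {2..n}"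
      hence "k = 1" by auto
      thus "(\<Prod>(i, j)\<in>pairs {1..<k}. up_factor n \<theta> s q t k i j * low_factor n \<theta> s q t k i j) *
       (\<Prod>i\<in>{1..<k}. up_factor n \<theta> s q t k i k * low_factor n \<theta> s q t k i i) = 1"
        by (simp add: pairs_def)
    qed
  qed auto
  finally show ?thesis .
qed

definition generic :: "complex \<Rightarrow> nat \<Rightarrow> (nat \<Rightarrow> complex) \<Rightarrow> bool" where
  "generic q n s \<longleftrightarrow> (\<forall>i\<in>{1..n}. s i \<noteq> 0) \<and>
     (\<forall>i\<in>{1..n}. \<forall>j\<in>{1..n}. \<forall>k::int. i \<noteq> j \<longrightarrow> s j / s i \<noteq> q powi k)"

lemma up_factor_bound:
  assumes "q \<noteq> 0" "norm q < 1" "t \<noteq> 0" "generic q n s" "i \<in> {1..n}" "j \<in> {1..n}" "i \<noteq> j"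
  obtains C where "C \<ge> 0"
    "\<And>\<theta>. norm (up_factor n \<theta> s q t k i j) \<le> C * norm (t / q) ^ min (\<theta> i k) (nat (- tail_diff n \<theta> k i j))"
proof -
  have s: "s i \<noteq> 0" "s j \<noteq> 0" using assms by (auto simp: generic_def)
  have "q * s j / s i \<noteq> q powi e" for e
  proof
    assume "q * s j / s i = q powi e"
    hence "s j / s i = q powi (e - 1)" using assms(1) s by (simp add: power_int_diff field_simps)
    thus False using assms by (auto simp: generic_def)
  qed
  then obtain C where C: "\<And>e m. norm (qpoch (q powi e * (t / q * (q * s j / s i))) q m / qpoch (q powi e * (q * s j / s i)) q m)
                 \<le> C * norm (t / q) ^ min m (nat (- e))"
    using qpoch_quotient_bound[of q "t / q" "q * s j / s i"] assms s by auto
  have "C \<ge> 0" using order_trans[OF norm_ge_zero C[of 0 0]] by simp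
  thus ?thesis using that[of C] C assms(1) unfolding up_factor_def by simp
qed

lemma low_factor_bound:
  assumes "q \<noteq> 0" "norm q < 1" "t \<noteq> 0" "generic q n s" "i \<in> {1..n}" "j \<in> {1..n}" "i \<noteq> j"
  obtains C where "C \<ge> 0"
    "\<And>\<theta>. norm (low_factor n \<theta> s q t k i j) \<le>
          C * norm (q / t) ^ min (\<theta> i k) (nat (int (\<theta> j k) - tail_diff n \<theta> k i j))"
proof -
  have s: "s i \<noteq> 0" "s j \<noteq> 0" "\<And>e. s j / s i \<noteq> q powi e" using assms by (auto simp: generic_def)
  then obtain C where C: "\<And>e m. norm (qpoch (q powi e * (q / t * (s j / s i))) q m / qpoch (q powi e * (s j / s i)) q m)
                 \<le> C * norm (q / t) ^ min m (nat (- e))"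
    using qpoch_quotient_bound[of q "q / t" "s j / s i"] assms s by auto
  have "C \<ge> 0" using order_trans[OF norm_ge_zero C[of 0 0]] by simp
  moreover have "norm (low_factor n \<theta> s q t k i j) \<le>
          C * norm (q / t) ^ min (\<theta> i k) (nat (int (\<theta> j k) - tail_diff n \<theta> k i j))" for \<theta>
    using C[of "- int (\<theta> j k) + tail_diff n \<theta> k i j" "\<theta> i k"] unfolding low_factor_def by simp
  ultimately show ?thesis using that by blast
qed

lemma qpoch_diagonal:
  assumes "q \<noteq> 0" "t \<noteq> 0"
  shows "qpoch (q powi (- int m) * (q / t)) q m / qpoch (q powi (- int m)) q m =
         (q / t) ^ m * (qpoch t q m / qpoch q q m)"
  using qpoch_quotient_reverse[of q "q / t" 1 m] assms by simp

text \<open>Separate from \<open>low_factor_bound\<close>, since for \<open>j = i\<close> the ratio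
  is 1, a power of \<open>q\<close>, which \<open>qpoch_quotient_bound\<close> excludes. Reversal
  gives an exact formula instead.\<close>

lemma low_factor_diagonal_bound:
  assumes "q \<noteq> 0" "norm q < 1" "t \<noteq> 0" "s i \<noteq> 0"
  obtains C where "C \<ge> 0" "\<And>\<theta>. norm (low_factor n \<theta> s q t k i i) \<le> C * norm (q / t) ^ \<theta> i k"
proof -
  have "q ^ p * q \<noteq> 1" for p
  proof
    assume "q ^ p * q = 1"
    hence "norm q ^ Suc p = 1" by (metis norm_one norm_power power_Suc2)
    moreover have "norm q ^ Suc p < 1" using assms by (intro power_Suc_less_one) auto
    ultimately show False by simp
  qed
  from inverse_qpoch_bounded[OF assms(2) this]
  obtain D where D: "\<And>m. norm (inverse (qpoch q q m)) \<le> D" by (metis mult_1 power_0)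
  obtain E where E: "\<And>m. norm (qpoch t q m) \<le> E" using qpoch_bounded[OF assms(2)] by blast
  have DE: "D \<ge> 0" "E \<ge> 0" using order_trans[OF norm_ge_zero D] order_trans[OF norm_ge_zero E] by auto
  show ?thesis
  proof
    show "E * D \<ge> 0" using DE by simp
    fix \<theta> :: "nat \<Rightarrow> nat \<Rightarrow> nat"
    have "tail_diff n \<theta> k i i = 0" by (simp add: tail_diff_def)
    hence "low_factor n \<theta> s q t k i i = (q / t) ^ \<theta> i k * (qpoch t q (\<theta> i k) / qpoch q q (\<theta> i k))"
      using assms qpoch_diagonal[OF assms(1,3)] by (simp add: low_factor_def)
    also have "norm \<dots> = norm (qpoch t q (\<theta> i k)) * norm (inverse (qpoch q q (\<theta> i k))) * norm (q / t) ^ \<theta> i k"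
      by (simp add: norm_mult norm_divide norm_power norm_inverse divide_inverse)
    also have "\<dots> \<le> E * D * norm (q / t) ^ \<theta> i k"
      by (intro mult_right_mono mult_mono D E DE) auto
    finally show "norm (low_factor n \<theta> s q t k i i) \<le> E * D * norm (q / t) ^ \<theta> i k" .
  qed
qed

text \<open>Since \<open>norm (q / t) \<le> 1\<close>, decay with the larger exponent outweighs
  growth at the inverse rate with the smaller one.\<close>

lemma compensated_product_bounded:
  fixes f g :: "'p \<Rightarrow> complex" and q t :: complex
  assumes "C \<ge> 0" "D \<ge> 0" "q \<noteq> 0" "t \<noteq> 0" "norm q \<le> norm t"
    and f: "\<And>p. norm (f p) \<le> C * norm (t / q) ^ \<alpha> p"
    and g: "\<And>p. norm (g p) \<le> D * norm (q / t) ^ \<beta> p"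
    and le: "\<And>p. \<alpha> p \<le> \<beta> p"
  shows "\<exists>C. \<forall>p. norm (f p * g p) \<le> C"
proof -
  have "norm (f p * g p) \<le> C * D" for p
  proof -
    define r where "r = norm (q / t)"
    have r: "0 < r" "r \<le> 1" "norm (t / q) = inverse r"
      using assms(3-5) by (auto simp: r_def norm_divide)
    have "r ^ \<beta> p \<le> r ^ \<alpha> p" using r le by (intro power_decreasing) auto
    hence "inverse r ^ \<alpha> p * r ^ \<beta> p \<le> 1" using r by (simp add: field_simps)
    moreover have "norm (f p * g p) \<le> (C * inverse r ^ \<alpha> p) * (D * r ^ \<beta> p)"
      unfolding norm_mult using f[of p] g[of p] assms(1) r by (intro mult_mono) (auto simp: r_def)
    moreover have "(C * inverse r ^ \<alpha> p) * (D * r ^ \<beta> p) = C * D * (inverse r ^ \<alpha> p * r ^ \<beta> p)" by simp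
    ultimately show ?thesis
      using mult_left_mono[of "inverse r ^ \<alpha> p * r ^ \<beta> p" 1 "C * D"]
        mult_nonneg_nonneg[OF assms(1,2)] by linarith
  qed
  thus ?thesis by blast
qed

lemma c_coeff_bounded:
  assumes "q \<noteq> 0" "norm q < 1" "t \<noteq> 0" "norm q \<le> norm t" "generic q n s"
  shows "\<exists>C. \<forall>\<theta>. norm (c_coeff n \<theta> s q t) \<le> C"
  unfolding c_coeff_alt
proof (rule bounded_prod[OF finite_atLeastAtMost])
  fix k assume k: "k \<in> {1..n}"
  have "\<exists>C. \<forall>\<theta>. norm (\<Prod>(i, j)\<in>pairs {1..<k}. up_factor n \<theta> s q t k i j * low_factor n \<theta> s q t k i j) \<le> C"
  proof (rule bounded_prod[OF finite_pairs[OF finite_atLeastLessThan]])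
    fix ij assume "ij \<in> pairs {1..<k}"
    with k obtain i j where ij: "ij = (i, j)" "i \<in> {1..n}" "j \<in> {1..n}" "i \<noteq> j"
      by (auto simp: pairs_def)
    obtain C where C: "C \<ge> 0" "\<And>\<theta>. norm (up_factor n \<theta> s q t k i j) \<le>
        C * norm (t / q) ^ min (\<theta> i k) (nat (- tail_diff n \<theta> k i j))"
      using up_factor_bound[OF assms(1-3,5) ij(2-4)] by blast
    obtain D where D: "D \<ge> 0" "\<And>\<theta>. norm (low_factor n \<theta> s q t k i j) \<le>
        D * norm (q / t) ^ min (\<theta> i k) (nat (int (\<theta> j k) - tail_diff n \<theta> k i j))"
      using low_factor_bound[OF assms(1-3,5) ij(2-4)] by blast
    \<comment> \<open>The exponents compare because the offset of the lower factor is smaller by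
      \<open>\<theta> j k \<ge> 0\<close>: \<open>- tail_diff n \<theta> k i j\<close> is at most
      \<open>int (\<theta> j k) - tail_diff n \<theta> k i j\<close>.\<close>
    show "\<exists>C. \<forall>\<theta>. norm (case ij of (i, j) \<Rightarrow> up_factor n \<theta> s q t k i j * low_factor n \<theta> s q t k i j) \<le> C"
      unfolding ij(1) prod.case
      by (rule compensated_product_bounded[OF C(1) D(1) assms(1,3,4) C(2) D(2)]) auto
  qed
  moreover have "\<exists>C. \<forall>\<theta>. norm (\<Prod>i\<in>{1..<k}. up_factor n \<theta> s q t k i k * low_factor n \<theta> s q t k i i) \<le> C"
  proof (rule bounded_prod[OF finite_atLeastLessThan])
    fix i assume i: "i \<in> {1..<k}"
    hence ik: "i \<in> {1..n}" "i \<noteq> k" using k by auto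
    hence "s i \<noteq> 0" using assms by (auto simp: generic_def)
    obtain C where C: "C \<ge> 0" "\<And>\<theta>. norm (up_factor n \<theta> s q t k i k) \<le>
        C * norm (t / q) ^ min (\<theta> i k) (nat (- tail_diff n \<theta> k i k))"
      using up_factor_bound[OF assms(1-3,5) ik(1) k ik(2)] by blast
    obtain D where D: "D \<ge> 0" "\<And>\<theta>. norm (low_factor n \<theta> s q t k i i) \<le> D * norm (q / t) ^ \<theta> i k"
      using low_factor_diagonal_bound[of q t s i n k] assms \<open>s i \<noteq> 0\<close> by metis
    \<comment> \<open>Here the diagonal factor decays with the full exponent
      \<open>\<theta> i k\<close>, which dominates the minimum in the bound for the upper
      factor.\<close>
    show "\<exists>C. \<forall>\<theta>. norm (up_factor n \<theta> s q t k i k * low_factor n \<theta> s q t k i i) \<le> C"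
      by (rule compensated_product_bounded[OF C(1) D(1) assms(1,3,4) C(2) D(2)]) auto
  qed
  ultimately show "\<exists>C. \<forall>\<theta>. norm
      ((\<Prod>(i, j)\<in>pairs {1..<k}. up_factor n \<theta> s q t k i j * low_factor n \<theta> s q t k i j) *
       (\<Prod>i\<in>{1..<k}. up_factor n \<theta> s q t k i k * low_factor n \<theta> s q t k i i)) \<le> C"
    by (rule bounded_mult)
qed

lemma strict_upper_mats_alt: "strict_upper_mats n = {\<theta>. \<forall>i j. \<theta> i j \<noteq> 0 \<longrightarrow> (i, j) \<in> pairs {1..n}}"
  unfolding strict_upper_mats_def pairs_atLeastAtMost by simp

definition theta_term :: "nat \<Rightarrow> (nat \<Rightarrow> complex) \<Rightarrow> complex \<Rightarrow> complex \<Rightarrow> (nat \<Rightarrow> nat \<Rightarrow> nat) \<Rightarrow> complex" where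
  "theta_term n s q t \<theta> = c_coeff n \<theta> s q t *
     t powi (\<Sum>(i, j)\<in>pairs {1..n}. (int i - int j) * int (\<theta> i j))"

text \<open>With bounded coefficients only the power of \<open>t\<close> matters. Its exponent is at
  most minus the sum of all entries, as \<open>i - j \<le> -1\<close>, so a multiple geometric
  series in \<open>1 / norm t\<close> dominates.\<close>

lemma theta_term_summable:
  assumes "q \<noteq> 0" "norm q < 1" "norm t > 1" "generic q n s"
  shows "(\<lambda>\<theta>. norm (theta_term n s q t \<theta>)) summable_on strict_upper_mats n"
proof -
  have "t \<noteq> 0" "norm q \<le> norm t" using assms(2,3) by auto
  from c_coeff_bounded[OF assms(1,2) this assms(4)]
  obtain C where C: "\<And>\<theta>. norm (c_coeff n \<theta> s q t) \<le> C" by blast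
  define r where "r = inverse (norm t)"
  have r: "0 < r" "r < 1" using assms(3) \<open>t \<noteq> 0\<close> by (simp_all add: r_def inverse_less_1_iff)
  have bij: "bij_betw (\<lambda>m i j. m (i, j)) (supp_on (pairs {1..n})) (strict_upper_mats n)"
    by (rule bij_betw_byWitness[of _ "\<lambda>\<theta> (i, j). \<theta> i j"])
       (auto simp: supp_on_def strict_upper_mats_alt fun_eq_iff)
  have le: "norm (theta_term n s q t (\<lambda>i j. m (i, j))) \<le> C * r ^ (\<Sum>ij\<in>pairs {1..n}. m ij)" for m
  proof -
    have "norm (t powi (\<Sum>(i, j)\<in>pairs {1..n}. (int i - int j) * int (m (i, j)))) =
        (\<Prod>(i, j)\<in>pairs {1..n}. norm t powi ((int i - int j) * int (m (i, j))))"
      using \<open>t \<noteq> 0\<close> by (simp add: norm_power_int power_int_sum case_prod_unfold flip: prod_norm)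
    also have "\<dots> \<le> (\<Prod>(i, j)\<in>pairs {1..n}. r ^ m (i, j))"
    proof (rule prod_mono, safe)
      fix i j assume ij: "(i, j) \<in> pairs {1..n}"
      show "0 \<le> norm t powi ((int i - int j) * int (m (i, j)))" by (simp add: zero_le_power_int)
      have "(int i - int j) * int (m (i, j)) \<le> (- 1) * int (m (i, j))"
        using ij by (intro mult_right_mono) (auto simp: pairs_def)
      hence "norm t powi ((int i - int j) * int (m (i, j))) \<le> norm t powi (- int (m (i, j)))"
        using assms(3) by (intro power_int_increasing) auto
      also have "\<dots> = r ^ m (i, j)" by (simp add: r_def power_int_minus power_inverse)
      finally show "norm t powi ((int i - int j) * int (m (i, j))) \<le> r ^ m (i, j)" .
    qed
    also have "\<dots> = r ^ (\<Sum>ij\<in>pairs {1..n}. m ij)"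
      by (simp add: power_sum case_prod_unfold)
    finally show ?thesis unfolding theta_term_def norm_mult
      using order_trans[OF norm_ge_zero C] by (intro mult_mono C) auto
  qed
  have "(\<lambda>m. norm (theta_term n s q t (\<lambda>i j. m (i, j)))) summable_on supp_on (pairs {1..n})"
  proof (rule Infinite_Sum.abs_summable_on_comparison_test'[OF _ le])
    show "(\<lambda>m. C * r ^ (\<Sum>ij\<in>pairs {1..n}. m ij)) summable_on supp_on (pairs {1..n})"
      using r by (intro summable_on_cmult_right summable_power_sum_supp_on) auto
  qed
  thus ?thesis using summable_on_reindex_bij_betw[OF bij, of "\<lambda>\<theta>. norm (theta_term n s q t \<theta>)"] by simp
qed

section \<open>Splitting off the last column\<close>

definition add_column :: "nat \<Rightarrow> (nat \<Rightarrow> nat) \<Rightarrow> (nat \<Rightarrow> nat \<Rightarrow> nat) \<Rightarrow> nat \<Rightarrow> nat \<Rightarrow> nat" where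
  "add_column N m \<theta> i j = (if j = Suc N then m i else \<theta> i j)"

lemma bij_betw_add_column:
  "bij_betw (\<lambda>(m, \<theta>). add_column N m \<theta>) (supp_on {1..N} \<times> strict_upper_mats N) (strict_upper_mats (Suc N))"
proof (rule bij_betw_byWitness[of _ "\<lambda>\<theta>. (\<lambda>i. \<theta> i (Suc N), \<lambda>i j. if j = Suc N then 0 else \<theta> i j)"])
  show "\<forall>p\<in>supp_on {1..N} \<times> strict_upper_mats N.
    (\<lambda>\<theta>. (\<lambda>i. \<theta> i (Suc N), \<lambda>i j. if j = Suc N then 0 else \<theta> i j)) ((\<lambda>(m, \<theta>). add_column N m \<theta>) p) = p"
  proof
    fix p assume p: "p \<in> supp_on {1..N} \<times> strict_upper_mats N"
    hence "\<forall>i j. snd p i j \<noteq> 0 \<longrightarrow> 1 \<le> i \<and> i < j \<and> j \<le> N"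
      by (simp add: strict_upper_mats_def mem_Times_iff)
    hence "snd p i (Suc N) = 0" for i by (metis Suc_n_not_le_n)
    thus "(\<lambda>\<theta>. (\<lambda>i. \<theta> i (Suc N), \<lambda>i j. if j = Suc N then 0 else \<theta> i j)) ((\<lambda>(m, \<theta>). add_column N m \<theta>) p) = p"
      by (cases p) (auto simp: add_column_def fun_eq_iff)
  qed
  show "\<forall>\<theta>\<in>strict_upper_mats (Suc N). (\<lambda>(m, \<theta>). add_column N m \<theta>)
      (\<lambda>i. \<theta> i (Suc N), \<lambda>i j. if j = Suc N then 0 else \<theta> i j) = \<theta>"
    by (auto simp: add_column_def fun_eq_iff)
  show "(\<lambda>(m, \<theta>). add_column N m \<theta>) ` (supp_on {1..N} \<times> strict_upper_mats N) \<subseteq> strict_upper_mats (Suc N)"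
  proof (safe)
    fix m \<theta> assume m: "m \<in> supp_on {1..N}" and \<theta>: "\<theta> \<in> strict_upper_mats N"
    have "1 \<le> i \<and> i < j \<and> j \<le> Suc N" if nz: "add_column N m \<theta> i j \<noteq> 0" for i j
    proof (cases "j = Suc N")
      case True
      hence "i \<in> {1..N}" using nz m unfolding add_column_def supp_on_def by simp
      thus ?thesis using True by simp
    next
      case False
      hence "1 \<le> i \<and> i < j \<and> j \<le> N" using nz \<theta> unfolding add_column_def strict_upper_mats_def by simp
      thus ?thesis by simp
    qed
    thus "add_column N m \<theta> \<in> strict_upper_mats (Suc N)" unfolding strict_upper_mats_def by blast
  qed
  show "(\<lambda>\<theta>. (\<lambda>i. \<theta> i (Suc N), \<lambda>i j. if j = Suc N then 0 else \<theta> i j)) ` strict_upper_mats (Suc N)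
      \<subseteq> supp_on {1..N} \<times> strict_upper_mats N"
  proof (safe)
    fix \<theta> assume "\<theta> \<in> strict_upper_mats (Suc N)"
    hence \<theta>: "1 \<le> i \<and> i < j \<and> j \<le> Suc N" if "\<theta> i j \<noteq> 0" for i j
      using that unfolding strict_upper_mats_def by blast
    have "i \<in> {1..N}" if "\<theta> i (Suc N) \<noteq> 0" for i using \<theta>[OF that] by simp
    thus "(\<lambda>i. \<theta> i (Suc N)) \<in> supp_on {1..N}" unfolding supp_on_def by blast
    have "1 \<le> i \<and> i < j \<and> j \<le> N" if "(if j = Suc N then 0 else \<theta> i j) \<noteq> 0" for i j
      using \<theta>[of i j] that by (cases "j = Suc N") auto
    thus "(\<lambda>i j. if j = Suc N then 0 else \<theta> i j) \<in> strict_upper_mats N"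
      unfolding strict_upper_mats_def by blast
  qed
qed

text \<open>The new column adds one term to every earlier tail. This is the origin of the shift of
  \<open>s\<close>.\<close>

lemma tail_diff_add_column:
  assumes "k \<le> N"
  shows "tail_diff (Suc N) (add_column N m \<theta>) k i j = tail_diff N \<theta> k i j + (int (m i) - int (m j))"
proof -
  have "(\<Sum>a=k+1..N. int (add_column N m \<theta> i a) - int (add_column N m \<theta> j a)) =
        (\<Sum>a=k+1..N. int (\<theta> i a) - int (\<theta> j a))"
    by (intro sum.cong refl) (auto simp: add_column_def)
  thus ?thesis using assms by (simp add: tail_diff_def add_column_def)
qed

lemma tail_diff_last: "tail_diff n \<theta> n i j = 0"
  by (simp add: tail_diff_def)

text \<open>The part \<open>k = Suc N\<close> of the coefficient, where the tails are empty and only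
  the entries \<open>m\<close> of the last column occur.\<close>

definition last_column :: "nat \<Rightarrow> (nat \<Rightarrow> complex) \<Rightarrow> complex \<Rightarrow> complex \<Rightarrow> (nat \<Rightarrow> nat) \<Rightarrow> complex" where
  "last_column N s q t m =
     (\<Prod>(i, j)\<in>pairs {1..N}.
        qpoch (t * s j / s i) q (m i) / qpoch (q * s j / s i) q (m i) *
        (qpoch (q powi (- int (m j)) * (q * s j / (t * s i))) q (m i) /
         qpoch (q powi (- int (m j)) * (s j / s i)) q (m i))) *
     (\<Prod>i=1..N. qpoch (t * s (Suc N) / s i) q (m i) / qpoch (q * s (Suc N) / s i) q (m i) *
        (qpoch (q powi (- int (m i)) * (q * s i / (t * s i))) q (m i) /
         qpoch (q powi (- int (m i)) * (s i / s i)) q (m i)))"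

definition shifted :: "complex \<Rightarrow> (nat \<Rightarrow> complex) \<Rightarrow> (nat \<Rightarrow> nat) \<Rightarrow> nat \<Rightarrow> complex" where
  "shifted q s m i = s i / q ^ m i"

lemma shifted_quotient:
  assumes "q \<noteq> 0"
  shows "shifted q s m j / shifted q s m i = q powi (int (m i) - int (m j)) * (s j / s i)"
  using assms by (simp add: shifted_def power_int_diff)

lemma c_coeff_add_column:
  assumes "q \<noteq> 0"
  shows "c_coeff (Suc N) (add_column N m \<theta>) s q t =
         c_coeff N \<theta> (shifted q s m) q t * last_column N s q t m"
proof -
  have shift: "q powi (e + (int (m i) - int (m j))) * (r * s j / (w * s i)) =
      q powi e * (r * shifted q s m j / (w * shifted q s m i))" for e r w i j
  proof -
    have "r * shifted q s m j / (w * shifted q s m i) = r / w * (shifted q s m j / shifted q s m i)" by simp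
    also have "\<dots> = r / w * (q powi (int (m i) - int (m j)) * (s j / s i))"
      by (simp only: shifted_quotient[OF assms])
    finally show ?thesis using assms by (simp add: power_int_add)
  qed
  have shift1: "q powi (e + (int (m i) - int (m j))) * (r * s j / s i) =
      q powi e * (r * shifted q s m j / shifted q s m i)" for e r i j
    using shift[where e = e and i = i and j = j and r = r and w = 1] by (simp only: mult_1)
  have shift2: "q powi (e + (int (m i) - int (m j))) * (s j / s i) =
      q powi e * (shifted q s m j / shifted q s m i)" for e i j
    using shift1[where e = e and i = i and j = j and r = 1] by (simp only: mult_1)
  have "up_factor (Suc N) (add_column N m \<theta>) s q t k i j = up_factor N \<theta> (shifted q s m) q t k i j"
    "low_factor (Suc N) (add_column N m \<theta>) s q t k i j = low_factor N \<theta> (shifted q s m) q t k i j"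
    if "k \<le> N" for k i j
  proof -
    have "add_column N m \<theta> i k = \<theta> i k" for i using that by (simp add: add_column_def)
    thus "up_factor (Suc N) (add_column N m \<theta>) s q t k i j = up_factor N \<theta> (shifted q s m) q t k i j"
      "low_factor (Suc N) (add_column N m \<theta>) s q t k i j = low_factor N \<theta> (shifted q s m) q t k i j"
      unfolding up_factor_def low_factor_def tail_diff_add_column[OF that] add.assoc[symmetric] shift shift1 shift2
      by simp_all
  qed
  hence "(\<Prod>k=1..N. (\<Prod>(i, j)\<in>pairs {1..<k}. up_factor (Suc N) (add_column N m \<theta>) s q t k i j *
             low_factor (Suc N) (add_column N m \<theta>) s q t k i j) *
     (\<Prod>i\<in>{1..<k}. up_factor (Suc N) (add_column N m \<theta>) s q t k i k *
             low_factor (Suc N) (add_column N m \<theta>) s q t k i i)) = c_coeff N \<theta> (shifted q s m) q t"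
    unfolding c_coeff_alt by (intro prod.cong refl) simp
  moreover have "{1..<Suc N} = {1..N}" by auto
  moreover have "add_column N m \<theta> i (Suc N) = m i" for i by (simp add: add_column_def)
  ultimately show ?thesis
    unfolding c_coeff_alt[of "Suc N"]
    by (simp add: last_column_def up_factor_def low_factor_def tail_diff_last)
qed

text \<open>Here \<open>x = s j / s i\<close>, \<open>m = m i\<close>, \<open>p = m j\<close>, and
  \<open>x'\<close> is the shifted ratio. A factorial of length \<open>m\<close> starting at
  \<open>q powi (- int p) * y\<close> joins the infinite product at the shifted point to form one
  infinite product, which is then cut at length \<open>p\<close> instead. Reversing the pieces of
  length \<open>p\<close> produces the factor for the opposite pair (j, i).\<close>

lemma pair_identity:
  assumes q: "q \<noteq> 0" "norm q < 1" and t: "t \<noteq> 0" and x: "x \<noteq> 0" "\<And>k::int. x \<noteq> q powi k"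
    and x': "x' = q powi (int m - int p) * x"
  shows "qpoch (q powi (- int p) * (q * x / t)) q m / qpoch (q powi (- int p) * x) q m *
           (qpoch_inf (q * x' / t) q / qpoch_inf (q * x') q) =
         (q ^ m - q ^ p / x) / (1 - 1 / x) * (qpoch (t / x) q p / qpoch (q / x) q p) * inverse t ^ p *
           (qpoch_inf (q * x / t) q / qpoch_inf (q * x) q)"
proof -
  have shift: "q ^ m * (q powi (- int p) * y) = q powi (int m - int p) * y"
    "q ^ p * (q powi (- int p) * y) = y" for y
    using q by (simp_all add: power_int_diff power_int_minus divide_inverse)
  have num: "qpoch (q powi (- int p) * (q * x / t)) q m * qpoch_inf (q * x' / t) q =
             qpoch (q powi (- int p) * (q * x / t)) q p * qpoch_inf (q * x / t) q"
    using qpoch_mult_inf[OF q(2), of "q powi (- int p) * (q * x / t)" m]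
      qpoch_mult_inf[OF q(2), of "q powi (- int p) * (q * x / t)" p]
    unfolding shift x' by (simp add: mult_ac)
  have den: "qpoch (q powi (- int p) * x) q m * qpoch_inf x' q =
             qpoch (q powi (- int p) * x) q p * qpoch_inf x q"
    using qpoch_mult_inf[OF q(2), of "q powi (- int p) * x" m]
      qpoch_mult_inf[OF q(2), of "q powi (- int p) * x" p]
    unfolding shift x' by simp
  have inf1: "qpoch_inf y q = (1 - y) * qpoch_inf (q * y) q" for y
    using qpoch_mult_inf[OF q(2), of y 1] by (simp add: qpoch_Suc)
  have ne1: "q powi e * x \<noteq> 1" for e
    using x(2)[of "- e"] q by (auto simp: power_int_minus field_simps)
  have one: "x \<noteq> 1" "x' \<noteq> 1" using ne1[of 0] ne1[of "int m - int p"] by (simp_all add: x')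
  have rev: "qpoch (q powi (- int p) * (q * x / t)) q p / qpoch (q powi (- int p) * x) q p =
             (q / t) ^ p * (qpoch (t / x) q p / qpoch (q / x) q p)"
    using qpoch_quotient_reverse[of q "q / t" x p] q t x by simp
  \<comment> \<open>The denominators join up at \<open>x'\<close>, while the infinite product starts
    at \<open>q * x'\<close>; the correction \<open>(1 - x') / (1 - x)\<close> is the Vandermonde
    factor. Its \<open>q ^ p\<close> absorbs that of \<open>(q / t) ^ p\<close>.\<close>
  have vand: "(q ^ m - q ^ p / x) / (1 - 1 / x) = q ^ p * ((1 - x') / (1 - x))"
  proof -
    have "q ^ p * x' = q ^ m * x" using q by (simp add: x' power_int_diff)
    moreover have "(q ^ m - q ^ p / x) / (1 - 1 / x) = (q ^ m * x - q ^ p) / (x - 1)"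
      using x(1) one by (simp add: divide_simps)
    moreover have "(1 - x') / (1 - x) = (x' - 1) / (x - 1)"
      by (metis minus_diff_eq minus_divide_divide)
    ultimately show ?thesis by (simp add: algebra_simps)
  qed
  have "qpoch (q powi (- int p) * (q * x / t)) q m / qpoch (q powi (- int p) * x) q m *
           (qpoch_inf (q * x' / t) q / qpoch_inf (q * x') q) =
        (qpoch (q powi (- int p) * (q * x / t)) q m * qpoch_inf (q * x' / t) q) * (1 - x') /
        (qpoch (q powi (- int p) * x) q m * qpoch_inf x' q)"
    using inf1[of x'] one by simp
  also have "\<dots> = (qpoch (q powi (- int p) * (q * x / t)) q p / qpoch (q powi (- int p) * x) q p) *
        ((1 - x') / (1 - x)) * (qpoch_inf (q * x / t) q / qpoch_inf (q * x) q)"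
    unfolding num den using inf1[of x] by (simp add: mult_ac)
  also have "\<dots> = (q ^ m - q ^ p / x) / (1 - 1 / x) * (qpoch (t / x) q p / qpoch (q / x) q p) * inverse t ^ p *
           (qpoch_inf (q * x / t) q / qpoch_inf (q * x) q)"
    unfolding rev vand by (simp add: divide_inverse power_mult_distrib power_inverse mult_ac)
  finally show ?thesis .
qed

lemma qgauss_An_inverse:
  assumes "q \<noteq> 0" "norm q < 1" "t \<noteq> 0" "generic q (Suc N) s"
  shows "qgauss_An q {1..N} (\<lambda>i. 1 / s i) (\<lambda>_. t) (t * s (Suc N))"
proof
  fix i j k assume ij: "i \<in> {1..N}" "j \<in> {1..N}" "i \<noteq> j"
  hence "s i \<noteq> 0" "s j \<noteq> 0" "s j / s i \<noteq> q powi k"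
    using assms(4) unfolding generic_def by auto
  thus "1 / s i \<noteq> q powi k * (1 / s j)" by (auto simp: field_simps)
qed (use assms in \<open>auto simp: generic_def\<close>)

lemma last_column_eq_summand:
  assumes q: "q \<noteq> 0" "norm q < 1" and t: "t \<noteq> 0" and s: "generic q (Suc N) s"
  shows "last_column N s q t m * t powi (\<Sum>i=1..N. (int i - int (Suc N)) * int (m i)) *
      (\<Prod>(i, j)\<in>pairs {1..N}. qpoch_inf (q * shifted q s m j / (t * shifted q s m i)) q /
          qpoch_inf (q * shifted q s m j / shifted q s m i) q) =
    qgauss_An.summand q {1..N} (\<lambda>i. 1 / s i) (\<lambda>_. t) (t * s (Suc N)) (q * s (Suc N)) m *
      (\<Prod>(i, j)\<in>pairs {1..N}. qpoch_inf (q * s j / (t * s i)) q / qpoch_inf (q * s j / s i) q)"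
proof -
  interpret G: qgauss_An q "{1..N}" "\<lambda>i. 1 / s i" "\<lambda>_. t" "t * s (Suc N)"
    by (rule qgauss_An_inverse[OF q t s])
  define U where "U i j p = qpoch (t * s j / s i) q p / qpoch (q * s j / s i) q p" for i j p
  define L where "L i j = qpoch (q powi (- int (m j)) * (q * s j / (t * s i))) q (m i) /
         qpoch (q powi (- int (m j)) * (s j / s i)) q (m i)" for i j
  define X where "X i j = qpoch_inf (q * s j / (t * s i)) q / qpoch_inf (q * s j / s i) q" for i j
  define X' where "X' i j = qpoch_inf (q * shifted q s m j / (t * shifted q s m i)) q /
          qpoch_inf (q * shifted q s m j / shifted q s m i) q" for i j
  define V where "V i j = (G.node m i - G.node m j) / (1 / s i - 1 / s j)" for i j
  have pair: "U i j (m i) * L i j * X' i j = V i j * (U i j (m i) * U j i (m j)) * inverse t ^ m j * X i j"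
    if "(i, j) \<in> pairs {1..N}" for i j
  proof -
    have ij: "s i \<noteq> 0" "s j \<noteq> 0" "s j / s i \<noteq> q powi k" for k
      using that s by (auto simp: pairs_def generic_def)
    have V: "V i j = (q ^ m i - q ^ m j / (s j / s i)) / (1 - 1 / (s j / s i))"
    proof -
      have "V i j = (s i * (G.node m i - G.node m j)) / (s i * (1 / s i - 1 / s j))"
        using ij by (simp add: V_def)
      thus ?thesis using ij by (simp add: G.node_def right_diff_distrib)
    qed
    define y where "y = s j / s i"
    define y' where "y' = shifted q s m j / shifted q s m i"
    have y: "q * s j / (t * s i) = q * y / t" "q * s j / s i = q * y" "s j / s i = y"
      "q * shifted q s m j / (t * shifted q s m i) = q * y' / t"
      "q * shifted q s m j / shifted q s m i = q * y'"
      "t * s i / s j = t / y" "q * s i / s j = q / y"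
      by (simp_all add: y_def y'_def)
    have "L i j * X' i j = V i j * U j i (m j) * inverse t ^ m j * X i j"
      unfolding L_def X'_def X_def U_def V y
    proof (rule pair_identity[OF q t])
      show "y \<noteq> 0" "y \<noteq> q powi k" for k using ij by (auto simp: y_def)
      show "y' = q powi (int (m i) - int (m j)) * y"
        unfolding y_def y'_def by (rule shifted_quotient[OF q(1)])
    qed
    thus ?thesis by simp
  qed
  have "last_column N s q t m = (\<Prod>(i, j)\<in>pairs {1..N}. U i j (m i) * L i j) *
      (\<Prod>i=1..N. U i (Suc N) (m i) * L i i)"
    unfolding last_column_def U_def L_def ..
  moreover have "L i i = U i i (m i) * (q / t) ^ m i" if "i \<in> {1..N}" for i
  proof -
    have "s i \<noteq> 0" using that s by (auto simp: generic_def)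
    thus ?thesis using qpoch_diagonal[OF q(1) t, of "m i"] by (simp add: L_def U_def mult.commute)
  qed
  ultimately have lc: "last_column N s q t m = (\<Prod>(i, j)\<in>pairs {1..N}. U i j (m i) * L i j) *
      (\<Prod>i=1..N. U i (Suc N) (m i) * U i i (m i) * (q / t) ^ m i)"
    by (simp add: mult.assoc)
  have "last_column N s q t m * (\<Prod>(i, j)\<in>pairs {1..N}. X' i j) =
      (\<Prod>(i, j)\<in>pairs {1..N}. U i j (m i) * L i j * X' i j) *
      (\<Prod>i=1..N. U i (Suc N) (m i) * U i i (m i) * (q / t) ^ m i)"
    unfolding lc by (simp add: prod.distrib case_prod_unfold)
  also have "(\<Prod>(i, j)\<in>pairs {1..N}. U i j (m i) * L i j * X' i j) =
     (\<Prod>(i, j)\<in>pairs {1..N}. V i j * (U i j (m i) * U j i (m j)) * inverse t ^ m j * X i j)"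
    using pair by (intro prod.cong refl) auto
  also have "\<dots> = G.vand {1..N} m * (\<Prod>(i, j)\<in>pairs {1..N}. U i j (m i) * U j i (m j)) *
      (\<Prod>i=1..N. (inverse t ^ m i) ^ (i - 1)) * (\<Prod>(i, j)\<in>pairs {1..N}. X i j)"
    unfolding G.vand_def V_def prod_pairs_snd[symmetric] case_prod_unfold prod.distrib by (simp only: mult.assoc)
  finally have main: "last_column N s q t m * (\<Prod>(i, j)\<in>pairs {1..N}. X' i j) =
      G.vand {1..N} m * ((\<Prod>(i, j)\<in>pairs {1..N}. U i j (m i) * U j i (m j)) * (\<Prod>i=1..N. U i i (m i))) *
      (\<Prod>i=1..N. U i (Suc N) (m i)) *
      (\<Prod>i=1..N. (inverse t ^ m i) ^ (i - 1) * (q / t) ^ m i) * (\<Prod>(i, j)\<in>pairs {1..N}. X i j)"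
    by (simp add: prod.distrib mult_ac)
  have wt: "G.weight (q * s (Suc N)) i (m i) = (\<Prod>j=1..N. U i j (m i)) * U i (Suc N) (m i)" for i
    unfolding G.weight_def U_def by simp
  \<comment> \<open>The index \<open>i\<close> is the larger member of \<open>i - 1\<close> pairs,
    each giving \<open>1 / t\<close>; the diagonal gives \<open>q / t\<close>, and the summand's own
    weight gives \<open>t powi (int i - int (Suc N))\<close>. The dependence on \<open>i\<close>
    cancels.\<close>
  have "(inverse t ^ m i) ^ (i - 1) * (q / t) ^ m i * t powi ((int i - int (Suc N)) * int (m i)) =
        (q / t ^ Suc N) ^ m i" if "i \<in> {1..N}" for i
  proof -
    have "(inverse t ^ m i) ^ (i - 1) = (inverse t ^ (i - 1)) ^ m i" by (metis power_mult mult.commute)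
    moreover have "t powi ((int i - int (Suc N)) * int (m i)) = (t powi (int i - int (Suc N))) ^ m i"
      by (simp only: power_int_mult power_int_of_nat)
    moreover have "inverse t ^ (i - 1) * (q / t) * t powi (int i - int (Suc N)) = q / t ^ Suc N"
    proof -
      have "t ^ i = t * t ^ (i - 1)" using that by (cases i) auto
      hence "t powi (int i - int (Suc N)) = t * t ^ (i - 1) / t ^ Suc N"
        using t by (simp only: power_int_diff power_int_of_nat simp_thms)
      thus ?thesis using t by (simp add: field_simps)
    qed
    ultimately show ?thesis by (metis power_mult_distrib)
  qed
  hence pow: "(\<Prod>i=1..N. (inverse t ^ m i) ^ (i - 1) * (q / t) ^ m i) *
      t powi (\<Sum>i=1..N. (int i - int (Suc N)) * int (m i)) = (q / t ^ Suc N) ^ (\<Sum>i=1..N. m i)"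
    unfolding power_int_sum[OF t] power_sum prod.distrib[symmetric] by (intro prod.cong refl) auto
  have arg: "G.arg (q * s (Suc N)) = q / t ^ Suc N"
    unfolding G.arg_def using s t by (simp add: generic_def mult_ac)
  have summ: "G.summand (q * s (Suc N)) m = G.vand {1..N} m *
      ((\<Prod>(i, j)\<in>pairs {1..N}. U i j (m i) * U j i (m j)) * (\<Prod>i=1..N. U i i (m i))) *
      (\<Prod>i=1..N. U i (Suc N) (m i)) * (q / t ^ Suc N) ^ (\<Sum>i=1..N. m i)"
    unfolding G.summand_def wt arg prod.distrib prod_square[OF finite_atLeastAtMost, of "\<lambda>i j. U i j (m i)", symmetric]
    by (simp only: mult_ac)
  have "last_column N s q t m * t powi (\<Sum>i=1..N. (int i - int (Suc N)) * int (m i)) *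
      (\<Prod>(i, j)\<in>pairs {1..N}. X' i j) =
    G.summand (q * s (Suc N)) m * (\<Prod>(i, j)\<in>pairs {1..N}. X i j)"
    unfolding summ pow[symmetric]
    using arg_cong[OF main, of "\<lambda>w. w * t powi (\<Sum>i=1..N. (int i - int (Suc N)) * int (m i))"]
    by (simp only: mult_ac)
  thus ?thesis unfolding X_def X'_def .
qed

section \<open>Induction on the size of the matrices\<close>

definition product_side :: "nat \<Rightarrow> (nat \<Rightarrow> complex) \<Rightarrow> complex \<Rightarrow> complex \<Rightarrow> complex" where
  "product_side n s q t = (\<Prod>i=1..n. qpoch_inf (q / t) q / qpoch_inf (q / t ^ i) q) *
     (\<Prod>(i, j)\<in>pairs {1..n}. qpoch_inf (q * s j / (t * s i)) q / qpoch_inf (q * s j / s i) q)"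

lemma generic_shifted:
  assumes "q \<noteq> 0" "generic q (Suc N) s"
  shows "generic q N (shifted q s m)"
  unfolding generic_def
proof safe
  fix i assume "i \<in> {1..N}" "shifted q s m i = 0"
  thus False using assms by (auto simp: generic_def shifted_def)
next
  fix i j k assume ij: "i \<in> {1..N}" "j \<in> {1..N}" "i \<noteq> j"
    and eq: "shifted q s m j / shifted q s m i = q powi k"
  have "s j / s i = q powi (k + int (m j) - int (m i))"
  proof -
    have "s j / s i = q powi k / q powi (int (m i) - int (m j))"
      using eq[symmetric] assms(1) unfolding shifted_quotient[OF assms(1)] by simp
    also have "\<dots> = q powi (k - (int (m i) - int (m j)))"
      using assms(1) by (simp only: power_int_diff simp_thms)
    finally show ?thesis by (simp add: algebra_simps)
  qed
  moreover have "s j / s i \<noteq> q powi (k + int (m j) - int (m i))"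
    using ij assms(2) unfolding generic_def by auto
  ultimately show False by blast
qed

text \<open>That the sum exists is known from \<open>theta_term_summable\<close>, so only its value
  is at stake, and it may be computed as an iterated sum. Starting at \<open>n = 0\<close> makes the
  base case a single matrix.\<close>

lemma theta_term_has_sum:
  assumes q: "q \<noteq> 0" "norm q < 1" and t: "norm t > 1" and s: "generic q n s"
  shows "(theta_term n s q t has_sum product_side n s q t) (strict_upper_mats n)"
  using s
proof (induction n arbitrary: s)
  case 0
  have "strict_upper_mats 0 = {\<lambda>_ _. 0}" by (auto simp: strict_upper_mats_def fun_eq_iff)
  moreover have "pairs {1..0::nat} = {}" by (auto simp: pairs_def)
  ultimately show ?case
    by (simp add: has_sum_finite_iff theta_term_def product_side_def c_coeff_alt)
next
  case (Suc N)
  have t0: "t \<noteq> 0" using t by auto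
  interpret G: qgauss_An q "{1..N}" "\<lambda>i. 1 / s i" "\<lambda>_. t" "t * s (Suc N)"
    by (rule qgauss_An_inverse[OF q t0 Suc.prems])
  have sn: "s (Suc N) \<noteq> 0" using Suc.prems by (auto simp: generic_def)
  let ?c = "q * s (Suc N)"
  have adm: "G.admissible ?c"
    unfolding G.admissible_def
  proof (intro conjI ballI allI)
    fix i p assume i: "i \<in> {1..N}"
    hence "s i \<noteq> 0" "s (Suc N) / s i \<noteq> q powi (- int (Suc p))"
      using Suc.prems unfolding generic_def by auto
    hence "s i \<noteq> 0" "s (Suc N) / s i \<noteq> inverse (q ^ Suc p)"
      unfolding power_int_minus power_int_of_nat by blast+
    thus "q ^ p * (?c * (1 / s i)) \<noteq> 1"
      using q by (auto simp: field_simps)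
  qed (use q sn in auto)
  have arg: "G.arg ?c = q / t ^ Suc N"
    unfolding G.arg_def using sn t0 by (simp add: mult_ac)
  have "norm (q / t ^ Suc N) < 1"
  proof -
    have "norm q < 1 ^ Suc N" using q by simp
    also have "\<dots> \<le> norm t ^ Suc N" using t by (intro power_mono) auto
    finally show ?thesis using t0 by (simp add: norm_divide norm_power norm_mult)
  qed
  hence arg_lt: "norm (G.arg ?c) < 1" by (simp only: arg)
  \<comment> \<open>The part of the inner value that does not depend on \<open>m\<close>.\<close>
  define K where "K = (\<Prod>i=1..N. qpoch_inf (q / t) q / qpoch_inf (q / t ^ i) q) *
     (\<Prod>(i, j)\<in>pairs {1..N}. qpoch_inf (q * s j / (t * s i)) q / qpoch_inf (q * s j / s i) q)"
  let ?S = "infsum (theta_term (Suc N) s q t) (strict_upper_mats (Suc N))"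
  have total: "(theta_term (Suc N) s q t has_sum ?S) (strict_upper_mats (Suc N))"
    by (rule has_sum_infsum[OF abs_summable_summable[OF theta_term_summable[OF q t Suc.prems]]])
  have joint: "((\<lambda>(m, \<theta>). theta_term (Suc N) s q t (add_column N m \<theta>)) has_sum ?S)
      (supp_on {1..N} \<times> strict_upper_mats N)"
    using total has_sum_reindex_bij_betw[OF bij_betw_add_column[of N], of "theta_term (Suc N) s q t" ?S]
    by (simp add: case_prod_unfold)
  have inner: "((\<lambda>\<theta>. theta_term (Suc N) s q t (add_column N m \<theta>)) has_sum K * G.summand ?c m)
      (strict_upper_mats N)" for m
  proof -
    define P where "P = last_column N s q t m * t powi (\<Sum>i=1..N. (int i - int (Suc N)) * int (m i))"
    have fac: "theta_term (Suc N) s q t (add_column N m \<theta>) = P * theta_term N (shifted q s m) q t \<theta>" for \<theta>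
    proof -
      have "pairs {1..Suc N} = pairs {1..N} \<union> (\<lambda>i. (i, Suc N)) ` {1..N}"
        "pairs {1..N} \<inter> (\<lambda>i. (i, Suc N)) ` {1..N} = {}" by (auto simp: pairs_def)
      hence "(\<Sum>(i, j)\<in>pairs {1..Suc N}. (int i - int j) * int (add_column N m \<theta> i j)) =
        (\<Sum>(i, j)\<in>pairs {1..N}. (int i - int j) * int (add_column N m \<theta> i j)) +
        (\<Sum>i=1..N. (int i - int (Suc N)) * int (add_column N m \<theta> i (Suc N)))"
        by (simp add: sum.union_disjoint sum.reindex inj_on_def)
      also have "\<dots> = (\<Sum>(i, j)\<in>pairs {1..N}. (int i - int j) * int (\<theta> i j)) +
        (\<Sum>i=1..N. (int i - int (Suc N)) * int (m i))"
        by (intro arg_cong2[of _ _ _ _ "(+)"] sum.cong refl) (auto simp: add_column_def pairs_def)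
      finally show ?thesis
        unfolding theta_term_def P_def c_coeff_add_column[OF q(1)]
        using t0 by (simp add: power_int_add)
    qed
    have "P * product_side N (shifted q s m) q t = K * G.summand ?c m"
      using last_column_eq_summand[OF q t0 Suc.prems, of m] unfolding P_def K_def product_side_def
      by (simp only: mult_ac)
    moreover have "((\<lambda>\<theta>. P * theta_term N (shifted q s m) q t \<theta>) has_sum
        P * product_side N (shifted q s m) q t) (strict_upper_mats N)"
      by (intro has_sum_cmult_right Suc.IH generic_shifted q Suc.prems)
    ultimately show ?thesis unfolding fac by simp
  qed
  have "((\<lambda>m. K * G.summand ?c m) has_sum ?S) (supp_on {1..N})"
    by (rule has_sum_SigmaD[OF joint]) (use inner in simp)
  moreover have "((\<lambda>m. K * G.summand ?c m) has_sum K * infsum (G.summand ?c) (supp_on {1..N})) (supp_on {1..N})"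
    by (intro has_sum_cmult_right has_sum_infsum abs_summable_summable[OF G.summand_summable[OF adm arg_lt]])
  ultimately have "?S = K * infsum (G.summand ?c) (supp_on {1..N})"
    using has_sum_unique by blast
  \<comment> \<open>The first quotient is the factor \<open>i = Suc N\<close> of the single product;
    the others are the pairs with \<open>j = Suc N\<close>, exactly what \<open>K\<close> is
    missing.\<close>
  also have "infsum (G.summand ?c) (supp_on {1..N}) = qpoch_inf (q / t) q / qpoch_inf (q / t ^ Suc N) q *
      (\<Prod>i=1..N. qpoch_inf (q * s (Suc N) / (t * s i)) q / qpoch_inf (q * s (Suc N) / s i) q)"
  proof -
    have "?c / (t * s (Suc N)) = q / t" using sn by simp
    moreover have "?c * (1 / s i) / t = q * s (Suc N) / (t * s i)" "?c * (1 / s i) = q * s (Suc N) / s i" for i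
      by simp_all
    ultimately show ?thesis
      using G.infsum_summand[OF adm arg_lt] by (simp only: arg)
  qed
  also have "K * \<dots> = product_side (Suc N) s q t"
  proof -
    have "{1..<Suc N} = {1..N}" by auto
    hence "(\<Prod>(i, j)\<in>pairs {1..Suc N}. f i j) =
      (\<Prod>(i, j)\<in>pairs {1..N}. f i j) * (\<Prod>i=1..N. f i (Suc N))" for f :: "nat \<Rightarrow> nat \<Rightarrow> complex"
      using prod_strict_upper[of f "Suc N"] by (simp only: pairs_atLeastAtMost[symmetric])
    thus ?thesis unfolding K_def product_side_def by (simp add: mult_ac)
  qed
  finally show ?case using total by simp
qed

theorem theorem1p7:
  fixes q t :: complex and s :: "nat \<Rightarrow> complex" and n :: nat
  assumes "q \<noteq> 0" and "norm q < 1" and "t \<noteq> 0"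
    and "n \<ge> 1"
    and "norm t > norm q powi (- (int n - 2))"
    and "\<And>i. 1 \<le> i \<Longrightarrow> i \<le> n \<Longrightarrow> s i \<noteq> 0"
    and "\<And>i j m. 1 \<le> i \<Longrightarrow> i < j \<Longrightarrow> j \<le> n \<Longrightarrow> s j / s i \<noteq> q powi (m::int)"
  shows "(\<lambda>\<theta>. norm (c_coeff n \<theta> s q t *
            t powi (\<Sum>(i, j)\<in>{(i, j). 1 \<le> i \<and> i < j \<and> j \<le> n}. (int i - int j) * int (\<theta> i j))))
           summable_on strict_upper_mats n \<and>
         (\<Sum>\<^sub>\<infinity>\<theta>\<in>strict_upper_mats n. c_coeff n \<theta> s q t *
            t powi (\<Sum>(i, j)\<in>{(i, j). 1 \<le> i \<and> i < j \<and> j \<le> n}. (int i - int j) * int (\<theta> i j))) =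
         (\<Prod>i=1..n. qpoch_inf (q / t) q / qpoch_inf (q / t ^ i) q) *
         (\<Prod>(i, j)\<in>{(i, j). 1 \<le> i \<and> i < j \<and> j \<le> n}.
            qpoch_inf (q * s j / (t * s i)) q / qpoch_inf (q * s j / s i) q)"
proof -
  have "(\<lambda>\<theta>. norm (theta_term n s q t \<theta>)) summable_on strict_upper_mats n \<and>
        infsum (theta_term n s q t) (strict_upper_mats n) = product_side n s q t"
  proof (cases "n = 1")
    \<comment> \<open>For \<open>n = 1\<close> the assumption on \<open>t\<close> reads
      \<open>norm t > norm q\<close>. It makes \<open>qpoch_inf (q / t) q\<close> nonzero, so that
      the only quotient on the right is 1 and not 0/0.\<close>
    case True
    have "pairs {1..1::nat} = {}" "pairs {1..<1::nat} = {}" by (auto simp: pairs_def)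
    moreover from this have "strict_upper_mats 1 = {\<lambda>_ _. 0}"
      unfolding strict_upper_mats_alt by (auto simp: fun_eq_iff)
    moreover have "qpoch_inf (q / t) q \<noteq> 0"
    proof (rule qpoch_inf_nonzero[OF assms(2)])
      fix k
      have "norm (q / t) < 1" using assms(3,5) True by (simp add: norm_divide)
      moreover have "norm (q ^ k * (q / t)) \<le> 1 * norm (q / t)"
        unfolding norm_mult norm_power using assms(2) by (intro mult_right_mono power_le_one) auto
      ultimately show "q ^ k * (q / t) \<noteq> 1" by (metis mult_1 norm_one not_less)
    qed
    ultimately show ?thesis
      using True by (simp add: theta_term_def product_side_def c_coeff_alt)
  next
    case False
    \<comment> \<open>For \<open>n \<ge> 2\<close> the lower bound for \<open>norm t\<close> is at
      least 1.\<close>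
    have "norm q powi (int n - 2) \<le> 1"
      using assms(1,2,4) False by (simp add: power_int_def power_le_one)
    moreover have "norm q powi (int n - 2) > 0" using assms(1) by (simp add: zero_less_power_int)
    ultimately have "1 \<le> inverse (norm q powi (int n - 2))" by (simp add: one_le_inverse)
    hence t: "norm t > 1" using assms(5) unfolding power_int_minus by linarith
    have "generic q n s"
      unfolding generic_def
    proof safe
      fix i assume "i \<in> {1..n}" "s i = 0"
      thus False using assms(6) by auto
    next
      fix i j k assume ij: "i \<in> {1..n}" "j \<in> {1..n}" "i \<noteq> j" and eq: "s j / s i = q powi k"
      \<comment> \<open>The theorem excludes powers of \<open>q\<close> only for
        \<open>i < j\<close>; inverting the ratio covers the other order.\<close>
      have "s i / s j = q powi (- k)" using eq by (simp add: power_int_minus flip: eq)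
      thus False using ij eq assms(7)[of i j k] assms(7)[of j i "- k"] by (cases "i < j") auto
    qed
    thus ?thesis
      using theta_term_summable[OF assms(1,2) t] theta_term_has_sum[OF assms(1,2) t] infsumI by blast
  qed
  thus ?thesis
    unfolding theta_term_def product_side_def pairs_atLeastAtMost .
qed

end
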